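(* Let $S=\{s_1,\dots,s_n\}$ be a finite poset whose Hasse graph $\Gamma(S)$ is connected, and suppose the quadratic form $f_S$ is positive semidefinite. Then $C(f_S)=\varnothing$ if and only if $S$ is isomorphic to $\zeta(r)$ for some rational number $r\ge 1$ (i.e. $S$ is an $r$-set).
   Context: For a finite poset $S=\{s_1,\dots,s_n\}$, $f_S(x_1,\dots,x_n)=\sum_{(i,j):\,s_i\le s_j}x_ix_j=\sum_i x_i^2+\sum_{s_i<s_j}x_ix_j$, so $\frac{\partial f_S}{\partial x_m}(x)=2x_m+\sum_{j\ne m,\ s_j\text{ comparable with }s_m}x_j$. Let $H_n=\{x\in\mathbb R^n:\sum_i x_i=0\}$. For a differentiable $f$ on $\mathbb R^n$, $C^-(f)=\{h\in H_n\setminus\{0\}: \frac{\partial f}{\partial x_i}(h)\le 0\ \forall i\}$, $C^+(f)=\{h\in H_n\setminus\{0\}: \frac{\partial f}{\partial x_i}(h)\ge 0\ \forall i\}$, $C(f)=C^+(f)\cup C^-(f)$. The Hasse graph $\Gamma(S)$ has vertex set $S$ and an edge between $s,s'$ when one covers the other. A wattle $\langle n_1,\dots,n_t\rangle$ ($t\ge2$, all $n_i\ge2$) is the poset which is a disjoint union of chains $Z_1,\dots,Z_t$ with $|Z_i|=n_i$, where for $i=1,\dots,t-1$ the minimal element of $Z_i$ is less than the maximal element of $Z_{i+1}$, and there are no other comparabilities between elements of different chains. For a non-integer rational $r>1$, write $r-[r]=q/t$ in lowest terms ($t\ge2$) and put $n_1=n_t=[r]+1$, $n_i=[ri]-[r(i-1)]+1$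 for $2\le i\le t-1$; then $\zeta(r)=\langle n_1,\dots,n_t\rangle$. For a positive integer $r$, $\zeta(r)$ is the chain with $r$ elements. ($[\cdot]$ is the integer part.) *)

theory Defs
  imports "HOL-Analysis.Analysis"
begin

definition finite_poset :: "'a set \<Rightarrow> ('a \<Rightarrow> 'a \<Rightarrow> bool) \<Rightarrow> bool" where
  "finite_poset S le \<longleftrightarrow> finite S
     \<and> (\<forall>x\<in>S. le x x)
     \<and> (\<forall>x\<in>S. \<forall>y\<in>S. le x y \<and> le y x \<longrightarrow> x = y)
     \<and> (\<forall>x\<in>S. \<forall>y\<in>S. \<forall>z\<in>S. le x y \<and> le y z \<longrightarrow> le x z)"

definition pless :: "('a \<Rightarrow> 'a \<Rightarrow> bool) \<Rightarrow> 'a \<Rightarrow> 'a \<Rightarrow> bool" where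
  "pless le x y \<longleftrightarrow> le x y \<and> x \<noteq> y"

definition covers :: "'a set \<Rightarrow> ('a \<Rightarrow> 'a \<Rightarrow> bool) \<Rightarrow> 'a \<Rightarrow> 'a \<Rightarrow> bool" where
  "covers S le x y \<longleftrightarrow> x \<in> S \<and> y \<in> S \<and> pless le x y
     \<and> \<not> (\<exists>z\<in>S. pless le x z \<and> pless le z y)"

definition hasse_edge :: "'a set \<Rightarrow> ('a \<Rightarrow> 'a \<Rightarrow> bool) \<Rightarrow> 'a \<Rightarrow> 'a \<Rightarrow> bool" where
  "hasse_edge S le x y \<longleftrightarrow> covers S le x y \<or> covers S le y x"

text \<open>The Hasse graph is connected (a connected graph has at least one vertex).\<close>
definition hasse_connected :: "'a set \<Rightarrow> ('a \<Rightarrow> 'a \<Rightarrow> bool) \<Rightarrow> bool" where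
  "hasse_connected S le \<longleftrightarrow> S \<noteq> {}
     \<and> (\<forall>x\<in>S. \<forall>y\<in>S. (hasse_edge S le)\<^sup>*\<^sup>* x y)"

text \<open>Vectors in R^n are functions S \<Rightarrow> real (extended by 0 outside S).
  f_S(x) = sum over pairs (i,j) with s_i \<le> s_j of x_i x_j.\<close>
definition fS :: "'a set \<Rightarrow> ('a \<Rightarrow> 'a \<Rightarrow> bool) \<Rightarrow> ('a \<Rightarrow> real) \<Rightarrow> real" where
  "fS S le x = (\<Sum>i\<in>S. \<Sum>j\<in>S. if le i j then x i * x j else 0)"

definition vec_on :: "'a set \<Rightarrow> ('a \<Rightarrow> real) set" where
  "vec_on S = {x. \<forall>i. i \<notin> S \<longrightarrow> x i = 0}"

definition hyperplane_H :: "'a set \<Rightarrow> ('a \<Rightarrow> real) set" where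
  "hyperplane_H S = {x \<in> vec_on S. (\<Sum>i\<in>S. x i) = 0}"

definition partial :: "(('a \<Rightarrow> real) \<Rightarrow> real) \<Rightarrow> 'a \<Rightarrow> ('a \<Rightarrow> real) \<Rightarrow> real" where
  "partial f m x = deriv (\<lambda>t. f (x(m := t))) (x m)"

definition Cminus :: "'a set \<Rightarrow> (('a \<Rightarrow> real) \<Rightarrow> real) \<Rightarrow> ('a \<Rightarrow> real) set" where
  "Cminus S f = {h \<in> hyperplane_H S. h \<noteq> (\<lambda>_. 0) \<and> (\<forall>i\<in>S. partial f i h \<le> 0)}"

definition Cplus :: "'a set \<Rightarrow> (('a \<Rightarrow> real) \<Rightarrow> real) \<Rightarrow> ('a \<Rightarrow> real) set" where
  "Cplus S f = {h \<in> hyperplane_H S. h \<noteq> (\<lambda>_. 0) \<and> (\<forall>i\<in>S. partial f i h \<ge> 0)}"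

definition Cset :: "'a set \<Rightarrow> (('a \<Rightarrow> real) \<Rightarrow> real) \<Rightarrow> ('a \<Rightarrow> real) set" where
  "Cset S f = Cplus S f \<union> Cminus S f"

definition psd_on :: "'a set \<Rightarrow> (('a \<Rightarrow> real) \<Rightarrow> real) \<Rightarrow> bool" where
  "psd_on S f \<longleftrightarrow> (\<forall>x\<in>vec_on S. f x \<ge> 0)"

text \<open>Disjoint union of chains Z_0,...,Z_{t-1} with |Z_i| = ns!i; element (i,k) is the
  k-th element of Z_i (k = 0 minimal, k = ns!i - 1 maximal), and the minimal element of Z_i
  is below the maximal element of Z_{i+1}; no other comparabilities between chains.
  With a one-element list this is just a chain.\<close>
definition wattle_carrier :: "nat list \<Rightarrow> (nat \<times> nat) set" where
  "wattle_carrier ns = {(i, k). i < length ns \<and> k < ns ! i}"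

definition wattle_le :: "nat list \<Rightarrow> nat \<times> nat \<Rightarrow> nat \<times> nat \<Rightarrow> bool" where
  "wattle_le ns a b \<longleftrightarrow>
     (fst a = fst b \<and> snd a \<le> snd b)
     \<or> (fst b = fst a + 1 \<and> snd a = 0 \<and> snd b = ns ! fst b - 1)"

text \<open>The sequence n_1,...,n_t (0-based list) of zeta(r).\<close>
definition zeta_list :: "rat \<Rightarrow> nat list" where
  "zeta_list r =
     (if r \<in> \<int> then [nat \<lfloor>r\<rfloor>]
      else (let t = nat (snd (quotient_of (r - of_int \<lfloor>r\<rfloor>))) in
        map (\<lambda>i. if i = 0 \<or> i = t - 1 then nat \<lfloor>r\<rfloor> + 1
                  else nat (\<lfloor>r * of_nat (i + 1)\<rfloor> - \<lfloor>r * of_nat i\<rfloor>) + 1) [0..<t]))"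

definition zeta_carrier :: "rat \<Rightarrow> (nat \<times> nat) set" where
  "zeta_carrier r = wattle_carrier (zeta_list r)"

definition zeta_le :: "rat \<Rightarrow> nat \<times> nat \<Rightarrow> nat \<times> nat \<Rightarrow> bool" where
  "zeta_le r = wattle_le (zeta_list r)"

definition poset_iso :: "'a set \<Rightarrow> ('a \<Rightarrow> 'a \<Rightarrow> bool) \<Rightarrow> 'b set \<Rightarrow> ('b \<Rightarrow> 'b \<Rightarrow> bool) \<Rightarrow> bool" where
  "poset_iso S le T le' \<longleftrightarrow>
     (\<exists>\<phi>. bij_betw \<phi> S T \<and> (\<forall>x\<in>S. \<forall>y\<in>S. le x y \<longleftrightarrow> le' (\<phi> x) (\<phi> y)))"

end

theory Submission
  imports Defs
begin

text \<open>
  Write \<open>A\<close> for the matrix of the gradient of \<open>f\<close>. If \<open>C(f)\<close> is empty, then \<open>f\<close> is positive definite and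
  the solution \<open>v\<close> of \<open>A v = 1\<close> is strictly positive: for \<open>v i = 0\<close>, or \<open>v i < 0 < v j\<close>, a
  nonnegative combination of \<open>A\<inverse> e i\<close> and \<open>A\<inverse> e j\<close> would lie in \<open>C(f)\<close>. Conversely a
  positive \<open>v\<close> with \<open>A v\<close> constant forces \<open>A h = 0\<close> for \<open>h\<close> in \<open>C(f)\<close>.

  Given \<open>v\<close>, intervals of \<open>S\<close> are chains, so that in the coordinates \<open>y i = \<Sum> j \<ge> i. x j\<close> the form
  \<open>f\<close> is the Tits form of the Hasse graph. By positive definiteness this graph is a tree with at
  most one branch vertex, whose arms of lengths \<open>l, m, n\<close> (counting the branch vertex) satisfy
  \<open>1/l + 1/m + 1/n > 1\<close>. The function \<open>z i = \<Sum> j \<le> i. v j\<close> takes values in \<open>(0, 1)\<close> and runs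
  through an arithmetic progression modulo 1 along every unbranched path. This contradicts the
  inequality at a branch vertex, so the Hasse graph is a path, with \<open>1 - z\<close> equal to the
  fractional part of \<open>k t / M\<close> at the \<open>k\<close>-th vertex, where \<open>M = card S + 1\<close> and
  \<open>t\<close> is coprime to \<open>M\<close>. The path descends in \<open>S\<close> except where \<open>k t / M\<close> passes an integer;
  the descending runs are the chains of \<open>\<zeta>((M - t) / t)\<close>.
\<close>

section \<open>The gradient and a positive solution\<close>

text \<open>Gaussian elimination, by induction on the set of equations: a nonzero coefficient in row
  \<open>i\<close> eliminates one equation and one unknown, and a zero row holds for every
  \<open>x\<close>.\<close>

lemma underdetermined_system:
  fixes a :: "'i \<Rightarrow> 'j \<Rightarrow> real"
  assumes "finite I" "finite J" "card I < card J"
  shows "\<exists>x. (\<exists>j\<in>J. x j \<noteq> 0) \<and> (\<forall>i\<in>I. (\<Sum>j\<in>J. a i j * x j) = 0)"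
  using assms
proof (induction I arbitrary: J a rule: finite_induct)
  case empty
  then have "J \<noteq> {}" by auto
  then show ?case by (intro exI[of _ "\<lambda>_. 1"]) auto
next
  case (insert i I)
  show ?case
  proof (cases "\<forall>j\<in>J. a i j = 0")
    case True
    from insert have "card I < card J" by simp
    from insert.IH[OF \<open>finite J\<close> this, of a] obtain x where
      x: "\<exists>j\<in>J. x j \<noteq> 0" "\<forall>i\<in>I. (\<Sum>j\<in>J. a i j * x j) = 0" by blast
    have "(\<Sum>j\<in>J. a i j * x j) = 0" using True by simp
    with x show ?thesis by blast
  next
    case False
    then obtain k where k: "k \<in> J" "a i k \<noteq> 0" by blast
    define J' where "J' = J - {k}"
    define a' where "a' l j = a l j - a l k * a i j / a i k" for l j
    have fJ': "finite J'" and kJ': "k \<notin> J'" and JJ: "J = insert k J'"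
      using insert.prems k by (auto simp: J'_def)
    have "card I < card J'" using insert.prems insert.hyps k fJ' kJ' JJ by simp
    from insert.IH[OF fJ' this, of a'] obtain x where
      x: "\<exists>j\<in>J'. x j \<noteq> 0" "\<forall>l\<in>I. (\<Sum>j\<in>J'. a' l j * x j) = 0" by blast
    \<comment> \<open>The value at \<open>k\<close> is chosen so that equation \<open>i\<close>
      holds; the rows of \<open>a'\<close> are those of \<open>a\<close> after substituting this
      value.\<close>
    define w where "w = x(k := - (\<Sum>j\<in>J'. a i j * x j) / a i k)"
    have eq: "(\<Sum>j\<in>J. a l j * w j) =
        (\<Sum>j\<in>J'. a l j * x j) - a l k * (\<Sum>j\<in>J'. a i j * x j) / a i k" for l
    proof -
      have "(\<Sum>j\<in>J'. a l j * w j) = (\<Sum>j\<in>J'. a l j * x j)"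
        using kJ' by (intro sum.cong) (auto simp: w_def)
      then show ?thesis using fJ' kJ' JJ by (simp add: w_def)
    qed
    have "(\<Sum>j\<in>J. a i j * w j) = 0" using eq[of i] k by simp
    moreover have "(\<Sum>j\<in>J. a l j * w j) = 0" if "l \<in> I" for l
    proof -
      have "(\<Sum>j\<in>J'. a' l j * x j) =
          (\<Sum>j\<in>J'. a l j * x j) - a l k * (\<Sum>j\<in>J'. a i j * x j) / a i k"
        by (simp add: a'_def left_diff_distrib sum_subtractf sum_distrib_left
            sum_divide_distrib mult.assoc)
      with eq[of l] x that show ?thesis by simp
    qed
    moreover have "\<exists>j\<in>J. w j \<noteq> 0" using x(1) kJ' JJ by (auto simp: w_def)
    ultimately show ?thesis by blast
  qed
qed

section \<open>The gradient as a symmetric linear map\<close>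

definition up_sum :: "'a set \<Rightarrow> ('a \<Rightarrow> 'a \<Rightarrow> bool) \<Rightarrow> ('a \<Rightarrow> real) \<Rightarrow> 'a \<Rightarrow> real" where
  "up_sum S le h i = (\<Sum>j\<in>S. if le i j then h j else 0)"

abbreviation down_sum :: "'a set \<Rightarrow> ('a \<Rightarrow> 'a \<Rightarrow> bool) \<Rightarrow> ('a \<Rightarrow> real) \<Rightarrow> 'a \<Rightarrow> real" where
  "down_sum S le \<equiv> up_sum S (\<lambda>x y. le y x)"

text \<open>For a reflexive order \<open>h i\<close> occurs in both sums, which yields the diagonal
  coefficient 2.\<close>

definition grad :: "'a set \<Rightarrow> ('a \<Rightarrow> 'a \<Rightarrow> bool) \<Rightarrow> ('a \<Rightarrow> real) \<Rightarrow> 'a \<Rightarrow> real" where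
  "grad S le h i = up_sum S le h i + down_sum S le h i"

lemma up_sum_cong: "(\<And>j. j \<in> S \<Longrightarrow> g j = h j) \<Longrightarrow> up_sum S le g i = up_sum S le h i"
  unfolding up_sum_def by (intro sum.cong) auto

lemma grad_cong: "(\<And>j. j \<in> S \<Longrightarrow> g j = h j) \<Longrightarrow> grad S le g i = grad S le h i"
  unfolding grad_def by (metis up_sum_cong)

lemma up_sum_linear:
  "up_sum S le (\<lambda>j. a * g j + b * h j) i = a * up_sum S le g i + b * up_sum S le h i"
  unfolding up_sum_def sum_distrib_left sum.distrib[symmetric]
  by (intro sum.cong) auto

lemma grad_linear:
  "grad S le (\<lambda>j. a * g j + b * h j) i = a * grad S le g i + b * grad S le h i"
  unfolding grad_def up_sum_linear by (simp add: algebra_simps)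

lemma grad_dual: "grad S (\<lambda>x y. le y x) = grad S le"
  by (intro ext) (simp add: grad_def)

lemma grad_matrix:
  "grad S le h i = (\<Sum>j\<in>S. ((if le i j then 1 else 0) + (if le j i then 1 else 0)) * h j)"
  unfolding grad_def up_sum_def sum.distrib[symmetric] by (intro sum.cong) auto

lemma grad_symmetric:
  "(\<Sum>i\<in>S. g i * grad S le h i) = (\<Sum>i\<in>S. h i * grad S le g i)"
proof -
  have "(\<Sum>i\<in>S. g i * grad S le h i) =
    (\<Sum>i\<in>S. \<Sum>j\<in>S. ((if le i j then 1 else 0) + (if le j i then 1 else 0)) * g i * h j)"
    by (simp add: grad_matrix sum_distrib_left algebra_simps)
  also have "\<dots> = (\<Sum>j\<in>S. \<Sum>i\<in>S. ((if le i j then 1 else 0) + (if le j i then 1 else 0)) * g i * h j)"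
    by (rule sum.swap)
  also have "\<dots> = (\<Sum>i\<in>S. h i * grad S le g i)"
    by (simp add: grad_matrix sum_distrib_left algebra_simps)
  finally show ?thesis .
qed

lemma fS_up_sum: "fS S le x = (\<Sum>i\<in>S. x i * up_sum S le x i)"
  unfolding fS_def up_sum_def sum_distrib_left by (intro sum.cong) auto

lemma fS_dual: "fS S (\<lambda>x y. le y x) x = fS S le x"
proof -
  have "fS S (\<lambda>x y. le y x) x = (\<Sum>i\<in>S. \<Sum>j\<in>S. if le i j then x j * x i else 0)"
    unfolding fS_def by (rule sum.swap)
  also have "\<dots> = fS S le x" unfolding fS_def by (intro sum.cong refl) auto
  finally show ?thesis .
qed

lemma fS_grad: "2 * fS S le x = (\<Sum>i\<in>S. x i * grad S le x i)"
proof -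
  have "(\<Sum>i\<in>S. x i * grad S le x i) = fS S le x + fS S (\<lambda>x y. le y x) x"
    unfolding grad_def fS_up_sum distrib_left sum.distrib ..
  then show ?thesis unfolding fS_dual[of S le x] by simp
qed

lemma fS_cong: "(\<And>j. j \<in> S \<Longrightarrow> g j = h j) \<Longrightarrow> fS S le g = fS S le h"
  unfolding fS_def by (intro sum.cong refl) auto

lemma up_sum_point:
  assumes "finite S" "m \<in> S"
  shows "up_sum S le (\<lambda>j. if j = m then 1 else 0) i = (if le i m then 1 else 0)"
proof -
  have "up_sum S le (\<lambda>j. if j = m then 1 else 0) i = (\<Sum>j\<in>S. if j = m then (if le i m then 1 else 0) else 0)"
    unfolding up_sum_def by (intro sum.cong) auto
  then show ?thesis using assms by (simp add: sum.delta)
qed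

lemma grad_point:
  assumes "finite S" "m \<in> S"
  shows "grad S le (\<lambda>j. if j = m then 1 else 0) i = (if le i m then 1 else 0) + (if le m i then 1 else 0)"
  using assms by (simp add: grad_def up_sum_point)

text \<open>The exact Taylor expansion in direction \<open>m\<close>; the coefficient of the square
  is 1 because the gradient of the point mass at \<open>m\<close> has value 2 at \<open>m\<close>.
  Both the partial derivative and the minimisation in \<open>psd_grad_zero\<close> are read off from
  it.\<close>

lemma fS_shift:
  assumes "finite S" "m \<in> S" "le m m"
  shows "fS S le (\<lambda>j. x j + s * (if j = m then 1 else 0)) = fS S le x + s * grad S le x m + s\<^sup>2"
proof -
  let ?e = "\<lambda>j. if j = m then 1 else (0::real)"
  have g: "grad S le (\<lambda>j. x j + s * ?e j) i = grad S le x i + s * grad S le ?e i" for i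
    using grad_linear[of S le 1 x s ?e i] by simp
  have e: "(\<Sum>i\<in>S. ?e i * u i) = u m" for u
  proof -
    have "(\<Sum>i\<in>S. ?e i * u i) = (\<Sum>i\<in>S. if i = m then u i else 0)" by (intro sum.cong) auto
    then show ?thesis using assms by simp
  qed
  have "2 * fS S le (\<lambda>j. x j + s * ?e j) =
     (\<Sum>i\<in>S. x i * grad S le x i) + s * (\<Sum>i\<in>S. x i * grad S le ?e i)
     + s * (\<Sum>i\<in>S. ?e i * grad S le x i) + s\<^sup>2 * (\<Sum>i\<in>S. ?e i * grad S le ?e i)"
    unfolding fS_grad g
    by (simp add: sum.distrib sum_distrib_left algebra_simps power2_eq_square)
  also have "(\<Sum>i\<in>S. x i * grad S le ?e i) = grad S le x m"
    unfolding grad_symmetric[of x] e ..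
  finally have "2 * fS S le (\<lambda>j. x j + s * ?e j) =
      2 * fS S le x + 2 * s * grad S le x m + s\<^sup>2 * grad S le ?e m"
    unfolding e fS_grad[of S le x, symmetric] by simp
  then show ?thesis using assms by (simp add: grad_point)
qed

lemma partial_fS:
  assumes "finite S" "m \<in> S" "le m m"
  shows "partial (fS S le) m x = grad S le x m"
proof -
  have eq: "(\<lambda>t. fS S le (x(m := t))) =
      (\<lambda>t. fS S le x + (t - x m) * grad S le x m + (t - x m)\<^sup>2)"
  proof
    fix t
    have "x(m := t) = (\<lambda>j. x j + (t - x m) * (if j = m then 1 else 0))" by auto
    then show "fS S le (x(m := t)) = fS S le x + (t - x m) * grad S le x m + (t - x m)\<^sup>2"
      using fS_shift[of S m le x "t - x m"] assms by simp
  qed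
  have "((\<lambda>t. fS S le x + (t - x m) * grad S le x m + (t - x m)\<^sup>2)
      has_real_derivative grad S le x m) (at (x m))"
    by (auto intro!: derivative_eq_intros)
  then show ?thesis unfolding partial_def eq by (rule DERIV_imp_deriv)
qed

section \<open>From an empty \<open>C(f)\<close> to a positive solution\<close>

definition no_ascent :: "'a set \<Rightarrow> ('a \<Rightarrow> 'a \<Rightarrow> bool) \<Rightarrow> bool" where
  "no_ascent S le \<longleftrightarrow>
    (\<forall>h. (\<Sum>i\<in>S. h i) = 0 \<and> (\<forall>i\<in>S. grad S le h i \<ge> 0) \<longrightarrow> (\<forall>i\<in>S. h i = 0))"

lemma no_ascentD:
  "no_ascent S le \<Longrightarrow> (\<Sum>i\<in>S. h i) = 0 \<Longrightarrow> (\<And>i. i \<in> S \<Longrightarrow> grad S le h i \<ge> 0) \<Longrightarrow> i \<in> S \<Longrightarrow> h i = 0"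
  unfolding no_ascent_def by blast

lemma no_descentD:
  assumes "no_ascent S le" "(\<Sum>i\<in>S. h i) = 0" "\<And>i. i \<in> S \<Longrightarrow> grad S le h i \<le> 0" "i \<in> S"
  shows "h i = 0"
proof -
  have "grad S le (\<lambda>j. - h j) k = - grad S le h k" for k
    using grad_linear[of S le "-1" h 0 h k] by simp
  then show ?thesis using no_ascentD[of S le "\<lambda>j. - h j" i] assms by (simp add: sum_negf)
qed

text \<open>Negation exchanges \<open>Cplus\<close> and \<open>Cminus\<close>, so one sign suffices.
  Since \<open>no_ascent\<close> leaves \<open>h\<close> free outside \<open>S\<close>, a
  counterexample to it is first truncated to a vector of \<open>vec_on S\<close>.\<close>

lemma Cset_empty_iff:
  assumes "finite S" "\<And>i. i \<in> S \<Longrightarrow> le i i"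
  shows "Cset S (fS S le) = {} \<longleftrightarrow> no_ascent S le"
proof
  assume L: "Cset S (fS S le) = {}"
  show "no_ascent S le" unfolding no_ascent_def
  proof (intro allI impI ballI, rule ccontr)
    fix h i
    assume h: "(\<Sum>i\<in>S. h i) = 0 \<and> (\<forall>i\<in>S. grad S le h i \<ge> 0)" and i: "i \<in> S" "h i \<noteq> 0"
    let ?g = "\<lambda>j. if j \<in> S then h j else 0"
    have "grad S le ?g j = grad S le h j" for j by (rule grad_cong) simp
    then have "?g \<in> Cplus S (fS S le)"
      using h i assms
      by (auto simp: Cplus_def hyperplane_H_def vec_on_def partial_fS fun_eq_iff)
    with L show False by (auto simp: Cset_def)
  qed
next
  assume R: "no_ascent S le"
  have "h = (\<lambda>_. 0)" if "h \<in> hyperplane_H S"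
    "(\<forall>i\<in>S. partial (fS S le) i h \<ge> 0) \<or> (\<forall>i\<in>S. partial (fS S le) i h \<le> 0)" for h
  proof -
    have "\<forall>i\<in>S. h i = 0"
      using that(2)
    proof
      assume "\<forall>i\<in>S. partial (fS S le) i h \<ge> 0"
      then have "\<And>i. i \<in> S \<Longrightarrow> grad S le h i \<ge> 0" using assms by (simp add: partial_fS)
      then show ?thesis using no_ascentD[OF R, of h] that(1) by (simp add: hyperplane_H_def)
    next
      assume "\<forall>i\<in>S. partial (fS S le) i h \<le> 0"
      then have "\<And>i. i \<in> S \<Longrightarrow> grad S le h i \<le> 0" using assms by (simp add: partial_fS)
      then show ?thesis using no_descentD[OF R, of h] that(1) by (simp add: hyperplane_H_def)
    qed
    then show ?thesis using that by (auto simp: hyperplane_H_def vec_on_def)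
  qed
  then show "Cset S (fS S le) = {}" by (auto simp: Cset_def Cplus_def Cminus_def)
qed

lemma psd_onD: "psd_on S (fS S le) \<Longrightarrow> 0 \<le> fS S le x"
proof -
  assume "psd_on S (fS S le)"
  then have "0 \<le> fS S le (\<lambda>j. if j \<in> S then x j else 0)" by (simp add: psd_on_def vec_on_def)
  also have "\<dots> = fS S le x" by (rule fS_cong) simp
  finally show ?thesis .
qed

text \<open>The parabola of \<open>fS_shift\<close> attains its minimum
  \<open>fS S le x - g\<^sup>2 / 4\<close> at \<open>s = - g / 2\<close>, and this value cannot be
  negative.\<close>

lemma psd_grad_zero:
  assumes "psd_on S (fS S le)" "finite S" "m \<in> S" "le m m" "fS S le x \<le> 0"
  shows "grad S le x m = 0"
proof -
  define g where "g = grad S le x m"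
  have "0 \<le> fS S le x + (- g / 2) * g + (- g / 2)\<^sup>2"
    unfolding g_def fS_shift[of S m le, OF assms(2-4), symmetric] by (rule psd_onD[OF assms(1)])
  also have "\<dots> = fS S le x - g\<^sup>2 / 4" by (simp add: power2_eq_square field_simps)
  finally have "g\<^sup>2 \<le> 0" using assms by linarith
  then show ?thesis by (simp add: g_def)
qed

lemma sum_option_insert:
  assumes "finite S"
  shows "(\<Sum>j\<in>insert None (Some ` S). f j) = f None + (\<Sum>s\<in>S. f (Some s))"
proof -
  have "(\<Sum>j\<in>Some ` S. f j) = (\<Sum>s\<in>S. f (Some s))" by (simp add: sum.reindex)
  then show ?thesis using assms by (subst sum.insert) auto
qed

lemma card_option_insert: "finite S \<Longrightarrow> card (insert None (Some ` S)) = Suc (card S)"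
  by (subst card_insert_disjoint) (auto simp: card_image)

text \<open>All products in the form are nonnegative here, and the diagonal ones are the squares of
  the \<open>u i\<close>.\<close>

lemma fS_nonneg_zero:
  assumes "finite S" "\<And>i. i \<in> S \<Longrightarrow> le i i" "\<And>i. i \<in> S \<Longrightarrow> 0 \<le> u i" "fS S le u = 0" "i \<in> S"
  shows "u i = 0"
proof -
  have "(\<Sum>i\<in>S. u i * up_sum S le u i) = 0" using assms(4) by (simp add: fS_up_sum)
  moreover have le: "u j \<le> up_sum S le u j" if "j \<in> S" for j
    unfolding up_sum_def using member_le_sum[of j S "\<lambda>k. if le j k then u k else 0"] assms that by auto
  moreover have "0 \<le> u j * up_sum S le u j" if "j \<in> S" for j
    using le[OF that] assms(3)[OF that] by (intro mult_nonneg_nonneg) auto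
  ultimately have "u i * up_sum S le u i = 0" using assms(1,5) by (simp add: sum_nonneg_eq_0_iff)
  then show ?thesis using le[OF assms(5)] assms(3)[OF assms(5)] by auto
qed

lemma grad_scale: "grad S le (\<lambda>j. a * h j) i = a * grad S le h i"
  using grad_linear[of S le a h 0 h i] by simp

text \<open>A kernel vector \<open>u\<close> takes both signs. For \<open>w \<ge> 0\<close> orthogonal to \<open>u\<close> the system
  \<open>grad g = \<tau> w\<close>, \<open>sum g = 0\<close> has one redundant equation, hence a nonzero solution \<open>(g, \<tau>)\<close>.\<close>

lemma no_ascent_grad_injective:
  assumes fin: "finite S" and refl: "\<And>i. i \<in> S \<Longrightarrow> le i i" and na: "no_ascent S le"
    and ker: "\<And>i. i \<in> S \<Longrightarrow> grad S le u i = 0" and i0: "i\<^sub>0 \<in> S"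
  shows "u i\<^sub>0 = 0"
proof (rule ccontr)
  assume "u i\<^sub>0 \<noteq> 0"
  have f0: "fS S le u = 0" using fS_grad[of S le u] ker by simp
  have f0': "fS S le (\<lambda>j. - u j) = 0"
    using fS_grad[of S le "\<lambda>j. - u j"] ker grad_scale[of S le "-1" u] by simp
  obtain a where a: "a \<in> S" "u a < 0"
    using fS_nonneg_zero[where le = le, OF fin refl _ f0 i0] \<open>u i\<^sub>0 \<noteq> 0\<close> not_le by blast
  obtain b where b: "b \<in> S" "u b > 0"
  proof -
    have "\<not> (\<forall>i\<in>S. 0 \<le> - u i)"
      using fS_nonneg_zero[where le = le, OF fin refl _ f0' i0] \<open>u i\<^sub>0 \<noteq> 0\<close> by auto
    then show ?thesis using that by force
  qed
  \<comment> \<open>Since \<open>u a < 0 < u b\<close>, both nonzero entries of \<open>w\<close> are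
    positive, and \<open>u a * u b - u b * u a = 0\<close> makes \<open>w\<close> orthogonal to
    \<open>u\<close>.\<close>
  define w where "w i = (if i = a then u b else 0) + (if i = b then - u a else 0)" for i
  define M where "M i j = (if le i j then 1 else 0) + (if le j i then 1 else (0::real))" for i j
  \<comment> \<open>As an unknown, \<open>None\<close> stands for the factor \<tau>; as an equation,
    it stands for the vanishing entry sum. Row \<open>b\<close> is left out of \<open>?I\<close> and
    recovered afterwards.\<close>
  define c where "c r j = (case r of
      None \<Rightarrow> (case j of None \<Rightarrow> 0 | Some j \<Rightarrow> 1)
    | Some i \<Rightarrow> (case j of None \<Rightarrow> - w i | Some j \<Rightarrow> M i j))" for r j :: "'a option"
  let ?I = "insert None (Some ` (S - {b}))" and ?J = "insert None (Some ` S)"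
  have "card ?I < card ?J"
    unfolding card_option_insert[OF fin] card_option_insert[OF finite_Diff[OF fin]]
    using card_Diff1_less[OF fin b(1)] by simp
  then obtain x where x: "\<exists>j\<in>?J. x j \<noteq> 0" "\<forall>i\<in>?I. (\<Sum>j\<in>?J. c i j * x j) = 0"
    using underdetermined_system[of ?I ?J c] fin by auto
  define g where "g j = x (Some j)" for j
  define \<tau> where "\<tau> = x None"
  have sg: "(\<Sum>j\<in>S. g j) = 0"
    using x(2)[rule_format, of None] unfolding sum_option_insert[OF fin] by (simp add: c_def g_def)
  have row: "grad S le g i = \<tau> * w i" if "i \<in> S" "i \<noteq> b" for i
    using x(2)[rule_format, of "Some i"] that unfolding sum_option_insert[OF fin]
    by (simp add: c_def g_def grad_matrix M_def \<tau>_def)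
  have uw: "(\<Sum>i\<in>S. u i * w i) = 0"
    using a b fin by (simp add: w_def distrib_left sum.distrib if_distrib[of "\<lambda>t. _ * t"] cong: if_cong)
  \<comment> \<open>The rows weighted by \<open>u i\<close> add up to zero, because
    \<open>grad\<close> is symmetric and kills \<open>u\<close> while \<open>w\<close> is orthogonal
    to \<open>u\<close>. As \<open>u b\<close> is nonzero, row \<open>b\<close> follows from the
    others.\<close>
  have rowb: "grad S le g b = \<tau> * w b"
  proof -
    have "(\<Sum>i\<in>S. u i * (grad S le g i - \<tau> * w i)) = (\<Sum>i\<in>S. u i * grad S le g i) - \<tau> * (\<Sum>i\<in>S. u i * w i)"
      by (simp add: right_diff_distrib sum_subtractf sum_distrib_left mult.left_commute)
    also have "\<dots> = 0" unfolding grad_symmetric[of u] uw using ker by simp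
    finally have "u b * (grad S le g b - \<tau> * w b) + (\<Sum>i\<in>S-{b}. u i * (grad S le g i - \<tau> * w i)) = 0"
      using sum.remove[OF fin b(1), of "\<lambda>i. u i * (grad S le g i - \<tau> * w i)"] by simp
    moreover have "(\<Sum>i\<in>S-{b}. u i * (grad S le g i - \<tau> * w i)) = 0"
      using row by (intro sum.neutral) auto
    ultimately show ?thesis using b by simp
  qed
  have grow: "grad S le g i = \<tau> * w i" if "i \<in> S" for i using row rowb that by blast
  have w0: "0 \<le> w i" for i using a b by (simp add: w_def)
  show False
  proof (cases "\<tau> = 0")
    case True
    then have "g j = 0" if "j \<in> S" for j
      using no_ascentD[OF na sg] grow that by simp
    with True x(1) show False by (auto simp: g_def \<tau>_def)
  next
    case False
    define h where "h j = (1/\<tau>) * g j" for j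
    have gh: "grad S le h i = w i" if "i \<in> S" for i
      unfolding h_def grad_scale using grow[OF that] False by simp
    have "(\<Sum>j\<in>S. h j) = 0" unfolding h_def using sg by (simp add: sum_divide_distrib[symmetric])
    then have h0: "h j = 0" if "j \<in> S" for j
      using no_ascentD[OF na, of h] gh w0 that by simp
    have "grad S le h a = grad S le (\<lambda>_. 0) a" by (rule grad_cong) (rule h0)
    also have "\<dots> = 0" using grad_scale[of S le 0] by simp
    finally have "w a = 0" using gh a by simp
    then show False using a b by (auto simp: w_def split: if_splits)
  qed
qed

text \<open>Scaling the right-hand side by an extra unknown \<tau> gives a homogeneous system with
  more unknowns than equations; injectivity excludes \<tau> = 0, so one can divide by it.\<close>

lemma grad_surjective:
  assumes fin: "finite S"
    and inj: "\<And>u. (\<And>i. i \<in> S \<Longrightarrow> grad S le u i = 0) \<Longrightarrow> (\<And>i. i \<in> S \<Longrightarrow> u i = 0)"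
  shows "\<exists>g. \<forall>i\<in>S. grad S le g i = w i"
proof -
  define M where "M i j = (if le i j then 1 else 0) + (if le j i then 1 else (0::real))" for i j
  define c where "c i j = (case j of None \<Rightarrow> - w i | Some j \<Rightarrow> M i j)" for i and j :: "'a option"
  let ?J = "insert None (Some ` S)"
  have "card S < card ?J" unfolding card_option_insert[OF fin] by simp
  then obtain x where x: "\<exists>j\<in>?J. x j \<noteq> 0" "\<forall>i\<in>S. (\<Sum>j\<in>?J. c i j * x j) = 0"
    using underdetermined_system[of S ?J c] fin by auto
  define g where "g j = x (Some j)" for j
  define \<tau> where "\<tau> = x None"
  have row: "grad S le g i = \<tau> * w i" if "i \<in> S" for i
    using x(2)[rule_format, of i] that unfolding sum_option_insert[OF fin]
    by (simp add: c_def g_def grad_matrix M_def \<tau>_def)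
  have "\<tau> \<noteq> 0"
  proof
    assume "\<tau> = 0"
    then have "g j = 0" if "j \<in> S" for j using inj[of g j] row that by simp
    with \<open>\<tau> = 0\<close> x(1) show False by (auto simp: g_def \<tau>_def)
  qed
  then have "\<forall>i\<in>S. grad S le (\<lambda>j. (1/\<tau>) * g j) i = w i"
    unfolding grad_scale using row by simp
  then show ?thesis by (rule exI[of _ "\<lambda>j. (1/\<tau>) * g j"])
qed

lemma no_ascent_positive_solution:
  assumes fin: "finite S" and ne: "S \<noteq> {}" and refl: "\<And>i. i \<in> S \<Longrightarrow> le i i"
    and psd: "psd_on S (fS S le)" and na: "no_ascent S le"
  obtains v where "\<And>i. i \<in> S \<Longrightarrow> grad S le v i = 1" "\<And>i. i \<in> S \<Longrightarrow> 0 < v i"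
proof -
  have inj: "u i = 0" if "\<And>i. i \<in> S \<Longrightarrow> grad S le u i = 0" "i \<in> S" for u i
    using no_ascent_grad_injective[of S le u i] fin refl na that by blast
  have surj: "\<exists>g. \<forall>i\<in>S. grad S le g i = w i" for w
    by (rule grad_surjective[OF fin]) (rule inj)
  obtain v where v: "\<And>i. i \<in> S \<Longrightarrow> grad S le v i = 1"
    using surj[of "\<lambda>_. 1"] by blast
  have "\<exists>g. \<forall>i\<in>S. grad S le g i = (if i = a then 1 else 0)" for a
    by (rule surj)
  then obtain G where G: "\<And>a i. i \<in> S \<Longrightarrow> grad S le (G a) i = (if i = a then 1 else 0)"
    by metis
  \<comment> \<open>\<open>G a\<close> is column \<open>a\<close> of the inverse of the gradient
    matrix. Pairing it with \<open>v\<close> shows that its entry sum is \<open>v a\<close>, so the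
    signs of \<open>v\<close> decide which nonnegative combinations of columns have entry sum
    zero.\<close>
  have sG: "(\<Sum>i\<in>S. G a i) = v a" if "a \<in> S" for a
  proof -
    have "(\<Sum>i\<in>S. G a i) = (\<Sum>i\<in>S. G a i * grad S le v i)" using v by simp
    also have "\<dots> = (\<Sum>i\<in>S. v i * grad S le (G a) i)" by (rule grad_symmetric)
    also have "\<dots> = (\<Sum>i\<in>S. if i = a then v i else 0)" using G by (intro sum.cong) auto
    finally show ?thesis using fin that by simp
  qed
  have key: "False" if "a \<in> S" "b \<in> S" "s \<ge> 0" "t \<ge> 0" "s + t > 0" "s * v a + t * v b = 0" for a b s t
  proof -
    define h where "h j = s * G a j + t * G b j" for j
    have gh: "grad S le h i = s * (if i = a then 1 else 0) + t * (if i = b then 1 else 0)" if "i \<in> S" for i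
      unfolding h_def grad_linear using G that by simp
    have "(\<Sum>i\<in>S. h i) = 0" unfolding h_def
      using sG that by (simp add: sum.distrib sum_distrib_left[symmetric])
    then have h0: "h j = 0" if "j \<in> S" for j
      using no_ascentD[OF na, of h] gh \<open>s \<ge> 0\<close> \<open>t \<ge> 0\<close> that by simp
    have "grad S le h i = 0" for i
      using grad_cong[of S h "\<lambda>_. 0 * 0" le i] h0 grad_scale[of S le 0 "\<lambda>_. 0" i] by simp
    then show False using gh[OF that(1)] gh[OF that(2)] that by (auto split: if_splits)
  qed
  have nz: "v a \<noteq> 0" if "a \<in> S" for a using key[of a a 1 1] that by auto
  have same: "\<not> (v a > 0 \<and> v b < 0)" if "a \<in> S" "b \<in> S" for a b
    using key[of a b "- v b" "v a"] that by (auto simp: algebra_simps)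
  \<comment> \<open>By \<open>nz\<close> and \<open>same\<close> all entries of \<open>v\<close> are
    nonzero with one common sign. Semidefiniteness makes their sum nonnegative, so that sign is
    positive.\<close>
  have "(\<Sum>i\<in>S. v i) = 2 * fS S le v" unfolding fS_grad using v by simp
  then have "0 \<le> (\<Sum>i\<in>S. v i)" using psd_onD[OF psd, of v] by simp
  moreover have "(\<Sum>i\<in>S. v i) < 0" if "\<And>i. i \<in> S \<Longrightarrow> v i < 0"
    using sum_strict_mono[OF fin ne, of v "\<lambda>_. 0"] that by simp
  ultimately obtain b where "b \<in> S" "\<not> v b < 0" by (meson not_le)
  then have "0 < v a" if "a \<in> S" for a
    using same[of b a] nz[of b] nz[of a] that by force
  with v show ?thesis by (rule that)
qed

text \<open>These assumptions are invariant under reversing the order, so each fact of the locale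
  also yields its dual, with the same \<open>v\<close>.\<close>

locale ascent_free_poset =
  fixes S :: "'a set" and le :: "'a \<Rightarrow> 'a \<Rightarrow> bool" and v :: "'a \<Rightarrow> real"
  assumes fin: "finite S"
    and refl: "x \<in> S \<Longrightarrow> le x x"
    and antisym: "x \<in> S \<Longrightarrow> y \<in> S \<Longrightarrow> le x y \<Longrightarrow> le y x \<Longrightarrow> x = y"
    and trans: "x \<in> S \<Longrightarrow> y \<in> S \<Longrightarrow> z \<in> S \<Longrightarrow> le x y \<Longrightarrow> le y z \<Longrightarrow> le x z"
    and na: "no_ascent S le"
    and pd: "(\<exists>i\<in>S. h i \<noteq> 0) \<Longrightarrow> 0 < fS S le h"
    and grad_v: "i \<in> S \<Longrightarrow> grad S le v i = 1"
    and v_pos: "i \<in> S \<Longrightarrow> 0 < v i"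

lemma ascent_free_posetI:
  assumes "finite_poset S le" "S \<noteq> {}" "psd_on S (fS S le)" "no_ascent S le"
  obtains v where "ascent_free_poset S le v"
proof -
  have fin: "finite S" and refl: "\<And>i. i \<in> S \<Longrightarrow> le i i" using assms by (auto simp: finite_poset_def)
  obtain v where v: "\<And>i. i \<in> S \<Longrightarrow> grad S le v i = 1" "\<And>i. i \<in> S \<Longrightarrow> 0 < v i"
    using no_ascent_positive_solution[where le = le, OF fin assms(2) refl assms(3,4)] by blast
  have "0 < fS S le x" if "\<exists>i\<in>S. x i \<noteq> 0" for x
  proof (rule ccontr)
    assume "\<not> 0 < fS S le x"
    then have "grad S le x i = 0" if "i \<in> S" for i
      using psd_grad_zero[OF assms(3) fin that refl[OF that], of x] by simp
    then show False using no_ascent_grad_injective[where le = le, OF fin refl assms(4)] that by blast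
  qed
  then have "ascent_free_poset S le v"
  proof unfold_locales
    show "le x z" if "x \<in> S" "y \<in> S" "z \<in> S" "le x y" "le y z" for x y z
      using assms(1) that unfolding finite_poset_def by blast
    show "x = y" if "x \<in> S" "y \<in> S" "le x y" "le y x" for x y
      using assms(1) that unfolding finite_poset_def by blast
  qed (use fin refl assms(4) v in \<open>simp_all\<close>)
  then show ?thesis by (rule that)
qed

lemma (in ascent_free_poset) dual: "ascent_free_poset S (\<lambda>x y. le y x) v"
proof unfold_locales
  show "no_ascent S (\<lambda>x y. le y x)" using na unfolding no_ascent_def grad_dual[of S le] .
  show "0 < fS S (\<lambda>x y. le y x) x" if "\<exists>i\<in>S. x i \<noteq> 0" for x
    unfolding fS_dual[of S le x] using pd that .
  show "le z x" if "x \<in> S" "y \<in> S" "z \<in> S" "le y x" "le z y" for x y z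
    using trans[of z y x] that by blast
  show "grad S (\<lambda>x y. le y x) v i = 1" if "i \<in> S" for i
    unfolding grad_dual[of S le] using grad_v[OF that] .
qed (use fin refl antisym v_pos in \<open>blast+\<close>)

section \<open>The Tits form of the Hasse graph\<close>

lemma covers_dual: "covers S (\<lambda>x y. le y x) x y \<longleftrightarrow> covers S le y x"
  unfolding covers_def pless_def by auto

lemma hasse_edge_dual: "hasse_edge S (\<lambda>x y. le y x) = hasse_edge S le"
  unfolding hasse_edge_def covers_dual[of S le] by auto

lemma hasse_edge_sym: "hasse_edge S le x y \<Longrightarrow> hasse_edge S le y x"
  unfolding hasse_edge_def by auto

lemma hasse_edge_in: "hasse_edge S le x y \<Longrightarrow> x \<in> S \<and> y \<in> S"
  unfolding hasse_edge_def covers_def by auto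

lemma hasse_edge_irrefl: "\<not> hasse_edge S le x x"
  unfolding hasse_edge_def covers_def pless_def by auto

context ascent_free_poset
begin

section \<open>Excluded subposets\<close>

abbreviation pt :: "'a \<Rightarrow> 'a \<Rightarrow> real" where "pt m \<equiv> \<lambda>j. if j = m then 1 else 0"

lemma grad_four:
  "grad S le (\<lambda>j. pt a j + pt b j - pt c j - pt d j) i
    = grad S le (pt a) i + grad S le (pt b) i - grad S le (pt c) i - grad S le (pt d) i"
proof -
  have eq: "(\<lambda>j. pt a j + pt b j - pt c j - pt d j)
    = (\<lambda>j. 1 * (1 * pt a j + 1 * pt b j) + (-1) * (1 * pt c j + 1 * pt d j))" by (simp add: algebra_simps)
  show ?thesis unfolding eq grad_linear by simp
qed

lemma sum_four:
  assumes "a \<in> S" "b \<in> S" "c \<in> S" "d \<in> S"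
  shows "(\<Sum>j\<in>S. pt a j + pt b j - pt c j - pt d j) = 0"
  using assms fin by (simp add: sum.distrib sum_subtractf)

text \<open>At each of the four points the gradient of \<open>?h\<close> is zero, two units from the
  diagonal cancelling against the two opposite points. Hence the form vanishes at the nonzero vector
  \<open>?h\<close>.\<close>

lemma no_crown:
  assumes S: "a \<in> S" "b \<in> S" "c \<in> S" "d \<in> S"
    and inc: "\<not> le a b" "\<not> le b a" "\<not> le c d" "\<not> le d c"
    and le: "le a c" "le a d" "le b c" "le b d"
  shows False
proof -
  let ?h = "\<lambda>j. pt a j + pt b j - pt c j - pt d j"
  have ne: "a \<noteq> b" "c \<noteq> d" "a \<noteq> c" "a \<noteq> d" "b \<noteq> c" "b \<noteq> d"
    using inc le refl S antisym by metis+
  have nle: "\<not> le c a" "\<not> le d a" "\<not> le c b" "\<not> le d b" using antisym S le ne by metis+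
  have g: "grad S le ?h a = 0" "grad S le ?h b = 0" "grad S le ?h c = 0" "grad S le ?h d = 0"
    unfolding grad_four using S inc le nle refl fin by (simp_all add: grad_point)
  have "(\<Sum>i\<in>S. ?h i * grad S le ?h i) = 0"
    using g ne by (intro sum.neutral) auto
  then have "fS S le ?h = 0" using fS_grad[of S le ?h] by simp
  moreover have "?h a \<noteq> 0" using ne by simp
  ultimately show False using pd[of ?h] S by fastforce
qed

text \<open>Here \<open>?h\<close> has entry sum zero and nowhere positive gradient, so it lies in
  \<open>Cminus\<close>. Outside the four points this holds because \<open>z\<close> is comparable
  with at least as many of \<open>p\<close>, \<open>q\<close> as of \<open>a\<close>,
  \<open>b\<close>.\<close>

lemma no_diamond:
  assumes S: "p \<in> S" "a \<in> S" "b \<in> S" "q \<in> S"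
    and inc: "\<not> le a b" "\<not> le b a" and le: "le p a" "le p b" "le a q" "le b q"
  shows False
proof -
  let ?h = "\<lambda>j. pt a j + pt b j - pt p j - pt q j"
  have ne: "a \<noteq> b" "p \<noteq> a" "p \<noteq> b" "q \<noteq> a" "q \<noteq> b" using inc le refl S by metis+
  have pq: "le p q" using trans[of p a q] S le by blast
  have "p \<noteq> q" using antisym[of p a] S le ne by metis
  have nle: "\<not> le a p" "\<not> le b p" "\<not> le q a" "\<not> le q b" "\<not> le q p"
    using antisym S le ne pq \<open>p \<noteq> q\<close> by metis+
  define cm where "cm x y = (if le x y then 1 else 0) + (if le y x then 1 else (0::real))" for x y
  have "grad S le ?h z \<le> 0" if z: "z \<in> S" for z
  proof -
    have g: "grad S le ?h z = cm z a + cm z b - cm z p - cm z q"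
      unfolding grad_four using S fin by (simp add: grad_point cm_def)
    consider "z = a \<or> z = b \<or> z = p \<or> z = q" | "z \<notin> {a,b,p,q}" by blast
    then show ?thesis
    proof cases
      case 1
      then show ?thesis unfolding g cm_def using S refl inc nle le pq by auto
    next
      case 2
      have one: "cm z x = (if le z x \<or> le x z then 1 else 0)" if "x \<in> {a,b,p,q}" for x
        using antisym[of z x] that 2 z S unfolding cm_def by auto
      have 3: "le z a \<or> le a z \<Longrightarrow> (le z p \<or> le p z) \<or> (le z q \<or> le q z)"
        using trans[of z a q] trans[of p a z] S z le by blast
      have 4: "le z b \<or> le b z \<Longrightarrow> (le z p \<or> le p z) \<or> (le z q \<or> le q z)"
        using trans[of z b q] trans[of p b z] S z le by blast
      \<comment> \<open>As \<open>a\<close> and \<open>b\<close> are incomparable, \<open>z\<close>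
        lies below both or above both. Transitivity settles one of \<open>p\<close>,
        \<open>q\<close>; incomparability with the other would give a crown.\<close>
      have 5: "(le z p \<or> le p z) \<and> (le z q \<or> le q z)"
        if za: "le z a \<or> le a z" and zb: "le z b \<or> le b z"
      proof -
        consider "le z a" "le z b" | "le a z" "le b z"
          using za zb trans[of a z b] trans[of b z a] S z inc by blast
        then show ?thesis
        proof cases
          case 1
          then have "le z q" using trans[of z a q] S z le by blast
          moreover have "le z p \<or> le p z" using no_crown[of z p a b] 1 S z le inc by blast
          ultimately show ?thesis by blast
        next
          case 2
          then have "le p z" using trans[of p a z] S z le by blast
          moreover have "le z q \<or> le q z" using no_crown[of a b z q] 2 S z le inc by blast
          ultimately show ?thesis by blast
        qed
      qed
      show ?thesis unfolding g using 3 4 5 one[of a] one[of b] one[of p] one[of q] by auto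
    qed
  qed
  moreover have "(\<Sum>j\<in>S. ?h j) = 0" using sum_four S by simp
  ultimately have "?h a = 0" using no_descentD[OF na, of ?h a] S by blast
  then show False using ne by simp
qed

section \<open>Inverting the order matrix by covers\<close>

lemma lower_cover_exists:
  assumes "i \<in> S" "k \<in> S" "le i k" "i \<noteq> k"
  shows "\<exists>j\<in>S. le i j \<and> covers S le j k"
proof -
  define X where "X = {j \<in> S. le i j \<and> pless le j k}"
  have "finite X" "X \<noteq> {}" using fin assms refl by (auto simp: X_def pless_def)
  \<comment> \<open>Counting the elements below is strictly monotone, so a maximiser of
    \<open>f\<close> is a maximal element of \<open>X\<close>.\<close>
  define f where "f j = card {l \<in> S. le l j}" for j
  obtain m where m: "m \<in> X" "f m = Max (f ` X)"
    using Max_in[of "f ` X"] \<open>finite X\<close> \<open>X \<noteq> {}\<close> by fastforce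
  have mS: "m \<in> S" "le i m" "pless le m k" using m by (auto simp: X_def)
  have "\<not> (pless le m z \<and> pless le z k)" if z: "z \<in> S" for z
  proof
    assume *: "pless le m z \<and> pless le z k"
    then have "z \<in> X" using z mS trans[of i m z] assms by (auto simp: X_def pless_def)
    then have "f z \<le> f m" using m \<open>finite X\<close> by simp
    moreover have "{l \<in> S. le l m} \<subset> {l \<in> S. le l z}"
    proof
      show "{l \<in> S. le l m} \<subseteq> {l \<in> S. le l z}"
        using * trans[of _ m z] mS z by (auto simp: pless_def)
      have "z \<in> {l \<in> S. le l z}" "z \<notin> {l \<in> S. le l m}"
        using refl z antisym[of z m] * mS by (auto simp: pless_def)
      then show "{l \<in> S. le l m} \<noteq> {l \<in> S. le l z}" by blast
    qed
    then have "f m < f z" unfolding f_def using fin by (intro psubset_card_mono) auto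
    ultimately show False by simp
  qed
  then have "covers S le m k" unfolding covers_def using mS assms by blast
  then show ?thesis using mS by blast
qed

text \<open>Two different lower covers of \<open>k\<close> are incomparable and would form a diamond
  with \<open>i\<close> and \<open>k\<close>.\<close>

lemma lower_cover_unique:
  assumes "i \<in> S" "le i j" "le i j'" "covers S le j k" "covers S le j' k"
  shows "j = j'"
proof (rule ccontr)
  assume "j \<noteq> j'"
  then have "\<not> le j j'" "\<not> le j' j" using assms(4,5) unfolding covers_def pless_def by blast+
  then show False using no_diamond[of i j j' k] assms unfolding covers_def pless_def by blast
qed

text \<open>In matrix form: the order matrix times the cover matrix is the strict order matrix.
  Hence the identity minus the cover matrix inverts the order matrix, which
  \<open>up_sum_minus_covers\<close> and \<open>v_up_sum\<close> use from either side.\<close>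

lemma sum_lower_covers:
  assumes "i \<in> S" "k \<in> S"
  shows "(\<Sum>j\<in>S. of_bool (le i j \<and> covers S le j k)) = (of_bool (le i k \<and> i \<noteq> k) :: real)"
proof (cases "le i k \<and> i \<noteq> k")
  case True
  then obtain j where j: "j \<in> S" "le i j" "covers S le j k"
    using lower_cover_exists assms by blast
  have "le i j' \<and> covers S le j' k \<longleftrightarrow> j' = j" for j'
    using lower_cover_unique[of i j j' k] assms j by blast
  then show ?thesis using True j fin by (simp add: of_bool_def)
next
  case False
  have "\<not> (le i j \<and> covers S le j k)" if "j \<in> S" for j
    using False trans[of i j k] antisym[of k j] assms that unfolding covers_def pless_def by blast
  then have "(\<Sum>j\<in>S. of_bool (le i j \<and> covers S le j k)) = (0::real)"
    by (intro sum.neutral) auto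
  then show ?thesis using False by simp
qed

lemma sum_upper_covers:
  assumes "i \<in> S" "k \<in> S"
  shows "(\<Sum>j\<in>S. of_bool (covers S le i j \<and> le j k)) = (of_bool (le i k \<and> i \<noteq> k) :: real)"
proof -
  interpret d: ascent_free_poset S "\<lambda>x y. le y x" v by (rule dual)
  show ?thesis using d.sum_lower_covers[OF assms(2,1)] unfolding covers_dual[of S le] by (simp add: conj_commute eq_commute[of k])
qed

lemma covers_in: "covers S le i j \<Longrightarrow> i \<in> S \<and> j \<in> S"
  by (simp add: covers_def)

lemma sum_covers: "(\<Sum>j | covers S le i j. g j) = (\<Sum>j\<in>S. of_bool (covers S le i j) * (g j :: real))"
proof -
  have "(\<Sum>j\<in>S. of_bool (covers S le i j) * g j) = (\<Sum>j\<in>S. if covers S le i j then g j else 0)"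
    by (intro sum.cong) auto
  also have "\<dots> = sum g (S \<inter> {j. covers S le i j})" using fin by (simp add: sum.inter_restrict)
  also have "S \<inter> {j. covers S le i j} = {j. covers S le i j}" using covers_in by blast
  finally show ?thesis by simp
qed

lemma up_sum_of_bool: "up_sum S le g i = (\<Sum>j\<in>S. of_bool (le i j) * g j)"
  unfolding up_sum_def by (intro sum.cong) auto

lemma up_sum_minus_covers:
  assumes "i \<in> S"
  shows "up_sum S le (\<lambda>j. y j - (\<Sum>k | covers S le j k. y k)) i = y i"
proof -
  have "(\<Sum>j\<in>S. of_bool (le i j) * (\<Sum>k | covers S le j k. y k))
      = (\<Sum>j\<in>S. \<Sum>k\<in>S. of_bool (le i j \<and> covers S le j k) * y k)"
    unfolding sum_covers sum_distrib_left by (intro sum.cong refl) auto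
  also have "\<dots> = (\<Sum>k\<in>S. \<Sum>j\<in>S. of_bool (le i j \<and> covers S le j k) * y k)" by (rule sum.swap)
  also have "\<dots> = (\<Sum>k\<in>S. of_bool (le i k \<and> i \<noteq> k) * y k)"
    unfolding sum_distrib_right[symmetric] using sum_lower_covers[OF assms]
    by (intro sum.cong) simp_all
  finally have "up_sum S le (\<lambda>j. y j - (\<Sum>k | covers S le j k. y k)) i
      = (\<Sum>k\<in>S. of_bool (le i k) * y k - of_bool (le i k \<and> i \<noteq> k) * y k)"
    unfolding up_sum_of_bool right_diff_distrib sum_subtractf by simp
  also have "\<dots> = (\<Sum>k\<in>S. if k = i then y k else 0)"
    using refl[OF assms] by (intro sum.cong) auto
  finally show ?thesis using assms fin by simp
qed

lemma v_up_sum: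
  assumes "i \<in> S"
  shows "v i = up_sum S le v i - (\<Sum>j | covers S le i j. up_sum S le v j)"
proof -
  have "(\<Sum>j | covers S le i j. up_sum S le v j)
      = (\<Sum>j\<in>S. \<Sum>k\<in>S. of_bool (covers S le i j \<and> le j k) * v k)"
    unfolding sum_covers up_sum_of_bool sum_distrib_left by (intro sum.cong refl) auto
  also have "\<dots> = (\<Sum>k\<in>S. \<Sum>j\<in>S. of_bool (covers S le i j \<and> le j k) * v k)" by (rule sum.swap)
  also have "\<dots> = (\<Sum>k\<in>S. of_bool (le i k \<and> i \<noteq> k) * v k)"
    unfolding sum_distrib_right[symmetric] using sum_upper_covers[OF assms]
    by (intro sum.cong) simp_all
  finally have "up_sum S le v i - (\<Sum>j | covers S le i j. up_sum S le v j)
      = (\<Sum>k\<in>S. of_bool (le i k) * v k - of_bool (le i k \<and> i \<noteq> k) * v k)"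
    unfolding up_sum_of_bool sum_subtractf by simp
  also have "\<dots> = (\<Sum>k\<in>S. if k = i then v k else 0)"
    using refl[OF assms] by (intro sum.cong) auto
  finally show ?thesis using assms fin by simp
qed

lemma finite_covers: "finite {j. covers S le i j}" "finite {j. covers S le j i}"
  by (rule finite_subset[OF _ fin], use covers_in in blast)+

lemma covers_asym: "covers S le i j \<Longrightarrow> \<not> covers S le j i"
  using antisym unfolding covers_def pless_def by blast

lemma sum_hasse_edge:
  "(\<Sum>j | hasse_edge S le i j. g j) = (\<Sum>j | covers S le i j. g j) + (\<Sum>j | covers S le j i. (g j :: real))"
proof -
  have "{j. hasse_edge S le i j} = {j. covers S le i j} \<union> {j. covers S le j i}"
    by (auto simp: hasse_edge_def)
  moreover have "{j. covers S le i j} \<inter> {j. covers S le j i} = {}" using covers_asym by blast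
  ultimately show ?thesis using finite_covers by (simp add: sum.union_disjoint)
qed

text \<open>In the coordinates \<open>y = up_sum x\<close> the form becomes the Tits form of the Hasse graph,
  which therefore admits no nonnegative subharmonic function.\<close>

lemma no_subharmonic:
  fixes y :: "'a \<Rightarrow> real"
  assumes y0: "\<And>i. i \<in> S \<Longrightarrow> 0 \<le> y i" and "a \<in> S" "0 < y a"
    and sub: "\<And>i. i \<in> S \<Longrightarrow> 0 < y i \<Longrightarrow> 2 * y i \<le> (\<Sum>j | hasse_edge S le i j. y j)"
  shows False
proof -
  define x where "x j = y j - (\<Sum>k | covers S le j k. y k)" for j
  have ux: "up_sum S le x i = y i" if "i \<in> S" for i
    unfolding x_def using up_sum_minus_covers[OF that] .
  have "\<exists>i\<in>S. x i \<noteq> 0"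
  proof (rule ccontr)
    assume "\<not> (\<exists>i\<in>S. x i \<noteq> 0)"
    then have "up_sum S le x a = 0" unfolding up_sum_def by (intro sum.neutral) auto
    then show False using ux[OF \<open>a \<in> S\<close>] \<open>0 < y a\<close> by simp
  qed
  then have pos: "0 < 2 * fS S le x" using pd by simp
  have two: "2 * fS S le x = (\<Sum>i\<in>S. 2 * (y i)\<^sup>2) - 2 * (\<Sum>i\<in>S. y i * (\<Sum>j | covers S le i j. y j))"
  proof -
    have "fS S le x = (\<Sum>i\<in>S. x i * y i)"
      unfolding fS_up_sum using ux by (intro sum.cong) simp_all
    also have "\<dots> = (\<Sum>i\<in>S. (y i)\<^sup>2 - y i * (\<Sum>j | covers S le i j. y j))"
      unfolding x_def left_diff_distrib power2_eq_square by (simp add: mult.commute)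
    finally show ?thesis by (simp add: sum_subtractf sum_distrib_left)
  qed
  \<comment> \<open>Exchanging the summations moves each cover term to the other end of its edge.
    Twice the sum over upper covers thus becomes a sum over all Hasse neighbours.\<close>
  have sw: "(\<Sum>i\<in>S. y i * (\<Sum>j | covers S le i j. y j)) = (\<Sum>i\<in>S. y i * (\<Sum>j | covers S le j i. y j))"
  proof -
    interpret d: ascent_free_poset S "\<lambda>x y. le y x" v by (rule dual)
    have e: "(\<Sum>j | covers S le j i. y j) = (\<Sum>j\<in>S. of_bool (covers S le j i) * y j)" for i
      using d.sum_covers[of y i] unfolding covers_dual[of S le] .
    have "(\<Sum>i\<in>S. y i * (\<Sum>j | covers S le i j. y j))
        = (\<Sum>i\<in>S. \<Sum>j\<in>S. of_bool (covers S le i j) * (y i * y j))"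
      unfolding sum_covers sum_distrib_left by (simp add: mult_ac)
    also have "\<dots> = (\<Sum>j\<in>S. \<Sum>i\<in>S. of_bool (covers S le i j) * (y i * y j))" by (rule sum.swap)
    also have "\<dots> = (\<Sum>i\<in>S. y i * (\<Sum>j | covers S le j i. y j))"
      unfolding e sum_distrib_left by (simp add: mult_ac)
    finally show ?thesis .
  qed
  have "2 * fS S le x = (\<Sum>i\<in>S. y i * (2 * y i - (\<Sum>j | hasse_edge S le i j. y j)))"
    unfolding two sum_hasse_edge right_diff_distrib distrib_left sum_subtractf sum.distrib sw[symmetric]
    by (simp add: power2_eq_square mult.left_commute)
  \<comment> \<open>Subharmonicity is known only where \<open>y\<close> is positive; elsewhere the
    factor \<open>y i\<close> annihilates the term.\<close>
  also have "\<dots> \<le> 0"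
  proof (rule sum_nonpos)
    fix i assume i: "i \<in> S"
    show "y i * (2 * y i - (\<Sum>j | hasse_edge S le i j. y j)) \<le> 0"
      using y0[OF i] sub[OF i] by (cases "y i = 0") (auto intro!: mult_nonneg_nonpos)
  qed
  finally show False using pos by simp
qed

end

section \<open>Graphs without nonnegative subharmonic functions\<close>

text \<open>\<open>no_sub\<close> amounts to the adjacency matrix having spectral radius below 2,
  the property that characterises disjoint unions of simply laced Dynkin diagrams. Each exclusion
  below exhibits a function \<open>g\<close> violating it.\<close>

locale dynkin_graph =
  fixes S :: "'a set" and E :: "'a \<Rightarrow> 'a \<Rightarrow> bool"
  assumes fin: "finite S"
    and sym: "E x y \<Longrightarrow> E y x"
    and irrefl: "\<not> E x x"
    and E_in: "E x y \<Longrightarrow> x \<in> S"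
    and no_sub: "(\<And>i. i \<in> S \<Longrightarrow> 0 \<le> (g i :: real)) \<Longrightarrow> a \<in> S \<Longrightarrow> 0 < g a
      \<Longrightarrow> (\<And>i. i \<in> S \<Longrightarrow> 0 < g i \<Longrightarrow> 2 * g i \<le> (\<Sum>j | E i j. g j)) \<Longrightarrow> False"
begin

lemma E_in2: "E x y \<Longrightarrow> y \<in> S" using E_in sym by blast

lemma fin_nbrs: "finite {j. E i j}"
  by (rule finite_subset[OF _ fin]) (use E_in2 in blast)

lemma nbr_sum_ge:
  fixes g :: "'a \<Rightarrow> real"
  assumes "\<And>j. 0 \<le> g j" "A \<subseteq> {j. E i j}"
  shows "sum g A \<le> (\<Sum>j | E i j. g j)"
  using sum_mono2[OF fin_nbrs assms(2), of g] assms(1) by blast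

text \<open>The indicator function of \<open>W\<close> would be subharmonic on its support.\<close>

lemma no_min_degree_two:
  assumes "W \<subseteq> S" "W \<noteq> {}"
    and "\<And>w. w \<in> W \<Longrightarrow> \<exists>a b. a \<in> W \<and> b \<in> W \<and> a \<noteq> b \<and> E w a \<and> E w b"
  shows False
proof -
  define g where "g w = (if w \<in> W then 1 else (0::real))" for w
  obtain a where a: "a \<in> W" using assms by blast
  have sub: "2 * g i \<le> (\<Sum>j | E i j. g j)" if "i \<in> S" "0 < g i" for i
  proof -
    have "i \<in> W" using that by (auto simp: g_def split: if_splits)
    then obtain b c where "b \<in> W" "c \<in> W" "b \<noteq> c" "E i b" "E i c" using assms(3) by blast
    then show ?thesis using nbr_sum_ge[of g "{b,c}" i] \<open>i \<in> W\<close> by (simp add: g_def)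
  qed
  have "a \<in> S" "0 < g a" "\<And>w. 0 \<le> g w" using a assms by (auto simp: g_def)
  with sub show False using no_sub[of g a] by blast
qed

section \<open>Paths and forbidden subgraphs\<close>

definition gpath :: "(nat \<Rightarrow> 'a) \<Rightarrow> nat \<Rightarrow> bool" where
  "gpath p n \<longleftrightarrow> inj_on p {..n} \<and> p 0 \<in> S \<and> (\<forall>k<n. E (p k) (p (Suc k)))"

lemma gpath_in: "gpath p n \<Longrightarrow> k \<le> n \<Longrightarrow> p k \<in> S"
proof (cases k)
  case (Suc m)
  assume "gpath p n" "k \<le> n"
  then show ?thesis using Suc E_in2[of "p m" "p k"] by (auto simp: gpath_def)
qed (simp add: gpath_def)

lemma gpath_eq: "gpath p n \<Longrightarrow> i \<le> n \<Longrightarrow> k \<le> n \<Longrightarrow> p i = p k \<longleftrightarrow> i = k"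
  by (auto simp: gpath_def inj_on_def)

lemma gpath_take: "gpath p n \<Longrightarrow> m \<le> n \<Longrightarrow> gpath p m"
  unfolding gpath_def by (auto intro: inj_on_subset)

lemma gpath_snoc:
  assumes "gpath p n" "E (p n) w" "w \<notin> p ` {..n}"
  shows "gpath (p(Suc n := w)) (Suc n)"
proof -
  have "inj_on (p(Suc n := w)) {..Suc n}"
    using assms by (auto simp: gpath_def inj_on_def atMost_Suc)
  then show ?thesis using assms by (auto simp: gpath_def less_Suc_eq)
qed

text \<open>The edge closes the segment \<open>p j\<close>, ..., \<open>p k\<close> to a cycle, in
  which every vertex has two neighbours. It follows in \<open>gpath_edge_iff\<close> that paths are
  induced subgraphs.\<close>

lemma no_cycle:
  assumes p: "gpath p n" and jk: "Suc (Suc j) \<le> k" "k \<le> n" and e: "E (p k) (p j)"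
  shows False
proof (rule no_min_degree_two)
  show "p ` {j..k} \<subseteq> S" using p gpath_in jk by auto
  show "p ` {j..k} \<noteq> {}" using jk by auto
  fix w assume "w \<in> p ` {j..k}"
  then obtain m where m: "j \<le> m" "m \<le> k" "w = p m" by auto
  have ed: "E (p i) (p (Suc i))" if "i < n" for i using p that by (auto simp: gpath_def)
  have eq: "p i = p l \<longleftrightarrow> i = l" if "i \<le> k" "l \<le> k" for i l using gpath_eq[OF p] that jk by auto
  consider "m = j" | "m = k" "j < k" | "j < m" "m < k" using m jk by linarith
  then show "\<exists>a b. a \<in> p ` {j..k} \<and> b \<in> p ` {j..k} \<and> a \<noteq> b \<and> E w a \<and> E w b"
  proof cases
    case 1
    then have "E w (p (Suc j))" "E w (p k)" using m ed[of j] jk sym[OF e] by auto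
    moreover have "p (Suc j) \<noteq> p k" using eq jk by auto
    ultimately show ?thesis using jk by (intro exI[of _ "p (Suc j)"] exI[of _ "p k"]) auto
  next
    case 2
    then have "E w (p (k - 1))" "E w (p j)" using m sym[OF ed[of "k - 1"]] jk e by auto
    moreover have "p (k - 1) \<noteq> p j" using eq jk by auto
    ultimately show ?thesis using jk by (intro exI[of _ "p (k - 1)"] exI[of _ "p j"]) auto
  next
    case 3
    then have "E w (p (m - 1))" "E w (p (Suc m))" using m sym[OF ed[of "m - 1"]] ed[of m] jk by auto
    moreover have "p (m - 1) \<noteq> p (Suc m)" using eq 3 by auto
    moreover have "m - 1 \<in> {j..k}" "Suc m \<in> {j..k}" using 3 by auto
    ultimately show ?thesis by blast
  qed
qed

lemma gpath_edge_iff: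
  assumes p: "gpath p n" and "i \<le> n" "k \<le> n"
  shows "E (p i) (p k) \<longleftrightarrow> k = Suc i \<or> i = Suc k"
proof
  assume e: "E (p i) (p k)"
  then have "i \<noteq> k" using irrefl by auto
  moreover have "\<not> Suc (Suc i) \<le> k" using no_cycle[OF p _ assms(3), of i] sym[OF e] by blast
  moreover have "\<not> Suc (Suc k) \<le> i" using no_cycle[OF p _ assms(2), of k] e by blast
  ultimately show "k = Suc i \<or> i = Suc k" by linarith
next
  assume "k = Suc i \<or> i = Suc k"
  then show "E (p i) (p k)" using p assms by (auto simp: gpath_def intro: sym)
qed

text \<open>The weights 2 at the centre and 1 at four neighbours form the null vector of the
  extended Dynkin diagram of type D4.\<close>

lemma degree_le_three:
  assumes "E i a" "E i b" "E i c" "E i d" "distinct [a, b, c, d]"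
  shows False
proof -
  define g where "g w = (if w = i then 2 else if w \<in> {a,b,c,d} then 1 else (0::real))" for w
  have g0: "0 \<le> g w" for w by (simp add: g_def)
  have ni: "i \<notin> {a,b,c,d}" using assms irrefl by auto
  have sub: "2 * g w \<le> (\<Sum>j | E w j. g j)" if "w \<in> S" "0 < g w" for w
  proof (cases "w = i")
    case True
    have "sum g {a,b,c,d} = 4" using assms ni by (auto simp: g_def)
    moreover have "{a,b,c,d} \<subseteq> {j. E i j}" using assms by auto
    moreover have "g i = 2" by (simp add: g_def)
    ultimately show ?thesis using nbr_sum_ge[of g "{a,b,c,d}" i, OF g0] True by simp
  next
    case False
    then have "w \<in> {a,b,c,d}" using that by (auto simp: g_def split: if_splits)
    then have "E w i" "g w = 1" using assms sym False by (auto simp: g_def)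
    moreover have "g i = 2" by (simp add: g_def)
    ultimately show ?thesis using nbr_sum_ge[of g "{i}" w, OF g0] by simp
  qed
  have "i \<in> S" "0 < g i" using assms E_in by (auto simp: g_def)
  with sub g0 show False using no_sub[of g i] by blast
qed

text \<open>The weights 2 along the path and 1 at the four extra neighbours form the null vector of
  an extended Dynkin diagram of type D.\<close>

lemma no_two_branch_vertices:
  assumes p: "gpath p n" "1 \<le> n"
    and a: "E (p 0) a" "E (p 0) a'" "a \<noteq> a'" "a \<noteq> p 1" "a' \<noteq> p 1"
    and b: "E (p n) b" "E (p n) b'" "b \<noteq> b'" "b \<noteq> p (n - 1)" "b' \<noteq> p (n - 1)"
  shows False
proof -
  let ?P = "p ` {..n}"
  have aP: "x \<notin> ?P" if "E (p 0) x" "x \<noteq> p 1" for x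
    using gpath_edge_iff[OF p(1), of 0] that by auto
  have bP: "x \<notin> ?P" if "E (p n) x" "x \<noteq> p (n - 1)" for x
    using gpath_edge_iff[OF p(1), of n] that p(2) by auto
  \<comment> \<open>A common extra neighbour of both ends would close the path to a cycle.\<close>
  have ab: "x \<noteq> y" if x: "E (p 0) x" "x \<noteq> p 1" and y: "E (p n) y" "y \<noteq> p (n - 1)" for x y
  proof
    assume "x = y"
    have "gpath (p(Suc n := y)) (Suc n)" using gpath_snoc[OF p(1) y(1) bP[OF y]] .
    from no_cycle[OF this, of 0 "Suc n"] show False using p(2) x \<open>x = y\<close> sym by auto
  qed
  have dist: "distinct [a, a', b, b']" using a b ab by auto
  have off: "a \<notin> ?P" "a' \<notin> ?P" "b \<notin> ?P" "b' \<notin> ?P" using aP bP a b by auto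
  define g where "g w = (if w \<in> ?P then 2 else if w \<in> {a,a',b,b'} then 1 else (0::real))" for w
  have g0: "0 \<le> g j" for j by (simp add: g_def)
  have ed: "E (p i) (p (Suc i))" if "i < n" for i using p that by (auto simp: gpath_def)
  have sub: "2 * g w \<le> (\<Sum>j | E w j. g j)" if "w \<in> S" "0 < g w" for w
  proof (cases "w \<in> ?P")
    case True
    then obtain k where k: "k \<le> n" "w = p k" by auto
    consider "k = 0" | "k = n" "0 < k" | "0 < k" "k < n" using k by linarith
    then show ?thesis
    proof cases
      case 1
      have "sum g {p 1, a, a'} \<le> (\<Sum>j | E w j. g j)"
        by (rule nbr_sum_ge[OF g0]) (use 1 k a ed[of 0] p(2) in auto)
      moreover have "sum g {p 1, a, a'} = 4" using a off p(2) by (auto simp: g_def)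
      ultimately show ?thesis using True by (simp add: g_def)
    next
      case 2
      have "sum g {p (n - 1), b, b'} \<le> (\<Sum>j | E w j. g j)"
        by (rule nbr_sum_ge[OF g0]) (use 2 k b sym[OF ed[of "n - 1"]] p(2) in auto)
      moreover have "sum g {p (n - 1), b, b'} = 4" using b off p(2) by (auto simp: g_def)
      ultimately show ?thesis using True by (simp add: g_def)
    next
      case 3
      have ne: "p (k - 1) \<noteq> p (Suc k)" using gpath_eq[OF p(1), of "k - 1" "Suc k"] 3 by auto
      have "sum g {p (k - 1), p (Suc k)} \<le> (\<Sum>j | E w j. g j)"
        by (rule nbr_sum_ge[OF g0]) (use 3 k ed[of k] sym[OF ed[of "k - 1"]] in auto)
      moreover have "sum g {p (k - 1), p (Suc k)} = 4" using ne 3 by (auto simp: g_def)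
      ultimately show ?thesis using True by (simp add: g_def)
    qed
  next
    case False
    then have "w \<in> {a,a',b,b'}" using that by (auto simp: g_def split: if_splits)
    then have "E w (p 0) \<or> E w (p n)" using a b sym by auto
    then obtain m where "m \<le> n" "E w (p m)" by auto
    moreover have "g w = 1" using False \<open>w \<in> {a,a',b,b'}\<close> by (simp add: g_def)
    moreover have "g (p m) = 2" using \<open>m \<le> n\<close> by (simp add: g_def)
    ultimately show ?thesis using nbr_sum_ge[of g "{p m}" w, OF g0] by simp
  qed
  have "p 0 \<in> S" "0 < g (p 0)" using gpath_in p by (auto simp: g_def)
  with sub g0 show False using no_sub[of g "p 0"] by blast
qed

text \<open>A longest path starting with \<open>i\<close>, \<open>a\<close> ends in a leaf: a
  further neighbour of its end would either prolong it or be a chord.\<close>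

lemma path_to_leaf:
  assumes "E i a"
  obtains p n where "1 \<le> n" "gpath p n" "p 0 = i" "p 1 = a" "\<And>w. E (p n) w \<longleftrightarrow> w = p (n - 1)"
proof -
  define Q where "Q n \<longleftrightarrow> 1 \<le> n \<and> (\<exists>p. gpath p n \<and> p 0 = i \<and> p 1 = a)" for n
  have "Q 1"
  proof -
    have "gpath (\<lambda>k. if k = 0 then i else a) 1"
      using assms irrefl E_in by (auto simp: gpath_def inj_on_def)
    then show ?thesis unfolding Q_def by (intro conjI exI[of _ "\<lambda>k. if k = 0 then i else a"]) auto
  qed
  moreover have bd: "n \<le> card S" if "Q n" for n
  proof -
    obtain p where "gpath p n" using \<open>Q n\<close> by (auto simp: Q_def)
    then have "card {..n} \<le> card S"
      using gpath_in by (intro card_inj_on_le[OF _ _ fin, of p]) (auto simp: gpath_def)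
    then show ?thesis by simp
  qed
  ultimately obtain n where n: "Q n" "\<And>m. Q m \<Longrightarrow> m \<le> n"
    using ex_has_greatest_nat[of Q 1 "\<lambda>x. x" "Suc (card S)"] by (auto simp: less_Suc_eq_le)
  then obtain p where p: "1 \<le> n" "gpath p n" "p 0 = i" "p 1 = a" by (auto simp: Q_def)
  have "w = p (n - 1)" if w: "E (p n) w" for w
  proof (cases "w \<in> p ` {..n}")
    case True
    then show ?thesis using gpath_edge_iff[OF p(2), of n] w p(1) by auto
  next
    case False
    have "Q (Suc n)" unfolding Q_def using gpath_snoc[OF p(2) w False] p
      by (intro conjI exI[of _ "p(Suc n := w)"]) auto
    then show ?thesis using n(2) by fastforce
  qed
  moreover have "E (p n) (p (n - 1))" using gpath_edge_iff[OF p(2), of n "n - 1"] p by auto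
  ultimately have "\<And>w. E (p n) w \<longleftrightarrow> w = p (n - 1)" by blast
  then show ?thesis using that p by blast
qed

section \<open>Arms of a branch vertex\<close>

definition arm :: "'a \<Rightarrow> 'a \<Rightarrow> (nat \<Rightarrow> 'a) \<Rightarrow> nat \<Rightarrow> bool" where
  "arm i a p n \<longleftrightarrow> 1 \<le> n \<and> gpath p n \<and> p 0 = i \<and> p 1 = a \<and> (\<forall>w. E (p n) w \<longleftrightarrow> w = p (n - 1))
    \<and> (\<forall>k w. 0 < k \<and> k < n \<longrightarrow> (E (p k) w \<longleftrightarrow> w = p (k - 1) \<or> w = p (Suc k)))"

lemma arm_exists:
  assumes "E i a" "E i b" "E i c" "distinct [a, b, c]"
  obtains p n where "arm i a p n"
proof -
  obtain p n where p: "1 \<le> n" "gpath p n" "p 0 = i" "p 1 = a" "\<And>w. E (p n) w \<longleftrightarrow> w = p (n - 1)"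
    using path_to_leaf[OF assms(1)] by metis
  have "E (p k) w \<longleftrightarrow> w = p (k - 1) \<or> w = p (Suc k)" if k: "0 < k" "k < n" for k w
  proof
    assume w: "E (p k) w"
    show "w = p (k - 1) \<or> w = p (Suc k)"
    proof (rule ccontr)
      assume ne: "\<not> (w = p (k - 1) \<or> w = p (Suc k))"
      have "gpath p k" using gpath_take p k by auto
      moreover have "E (p k) (p (Suc k))" using gpath_edge_iff[OF p(2)] k by auto
      moreover have "p (Suc k) \<noteq> p (k - 1)" using gpath_eq[OF p(2)] k by auto
      \<comment> \<open>A third neighbour \<open>w\<close> of \<open>p k\<close> would make
        \<open>p k\<close> a second branch vertex, joined to \<open>i\<close> by the initial segment
        of \<open>p\<close>; the extra neighbours at \<open>i\<close> are \<open>b\<close> and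
        \<open>c\<close>.\<close>
      ultimately show False
        using no_two_branch_vertices[of p k b c w "p (Suc k)"] assms p ne k w by auto
    qed
  next
    assume "w = p (k - 1) \<or> w = p (Suc k)"
    then show "E (p k) w" using gpath_edge_iff[OF p(2)] k by auto
  qed
  then have "arm i a p n" unfolding arm_def using p by blast
  then show ?thesis by (rule that)
qed

text \<open>Linear along the arm, from 1 at the branch vertex down to 0 at an imaginary vertex
  beyond the leaf. For this reason \<open>laplace\<close> vanishes on the arm, the leaf included,
  except at the branch vertex.\<close>

definition arm_weight :: "(nat \<Rightarrow> 'a) \<Rightarrow> nat \<Rightarrow> 'a \<Rightarrow> real" where
  "arm_weight p n w = (if w \<in> p ` {..n} then 1 - real (the_inv_into {..n} p w) / (n + 1) else 0)"

definition laplace :: "('a \<Rightarrow> real) \<Rightarrow> 'a \<Rightarrow> real" where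
  "laplace g w = (\<Sum>j | E w j. g j) - 2 * g w"

lemma arm_weight_path: "gpath p n \<Longrightarrow> k \<le> n \<Longrightarrow> arm_weight p n (p k) = 1 - real k / (n + 1)"
  by (auto simp: arm_weight_def gpath_def the_inv_into_f_f)

lemma arm_weight_nonneg:
  assumes "gpath p n"
  shows "0 \<le> arm_weight p n w"
proof (cases "w \<in> p ` {..n}")
  case True
  then obtain k where "k \<le> n" "w = p k" by auto
  then show ?thesis using arm_weight_path[OF assms] by simp
qed (simp add: arm_weight_def)

lemma laplace_arm_weight_on:
  assumes "arm i a p n" "0 < k" "k \<le> n"
  shows "laplace (arm_weight p n) (p k) = 0"
proof -
  have g: "gpath p n" using assms by (simp add: arm_def)
  define N where "N = real n + 1"
  have N: "N > 0" by (simp add: N_def)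
  have wk: "arm_weight p n (p k) = 1 - real k / N"
    and wl: "arm_weight p n (p (k - 1)) = 1 - (real k - 1) / N"
    using arm_weight_path[OF g, of k] arm_weight_path[OF g, of "k - 1"] assms
    by (auto simp: of_nat_diff N_def add.commute)
  show ?thesis
  proof (cases "k = n")
    case True
    have "{w. E (p k) w} = {p (k - 1)}" using assms True by (auto simp: arm_def)
    then have "laplace (arm_weight p n) (p k) = (1 - (real k - 1) / N) - 2 * (1 - real k / N)"
      by (simp add: laplace_def wk wl[simplified])
    also have "\<dots> = 0" using True N by (simp add: N_def field_simps)
    finally show ?thesis .
  next
    case False
    then have "{w. E (p k) w} = {p (k - 1), p (Suc k)}" using assms by (auto simp: arm_def)
    moreover have "p (k - 1) \<noteq> p (Suc k)" using gpath_eq[OF g, of "k - 1" "Suc k"] assms False by auto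
    moreover have "arm_weight p n (p (Suc k)) = 1 - (real k + 1) / N"
      using arm_weight_path[OF g, of "Suc k"] assms False by (simp add: N_def add.commute)
    ultimately have "laplace (arm_weight p n) (p k)
        = (1 - (real k - 1) / N) + (1 - (real k + 1) / N) - 2 * (1 - real k / N)"
      by (simp add: laplace_def wk wl[simplified])
    also have "\<dots> = 0" by (simp add: diff_divide_distrib add_divide_distrib)
    finally show ?thesis .
  qed
qed

text \<open>Only the starting vertex \<open>i\<close> of an arm has neighbours off the arm, and its
  weight is 1.\<close>

lemma laplace_arm_weight_off:
  assumes "arm i a p n" "w \<notin> p ` {..n}"
  shows "laplace (arm_weight p n) w = (if E i w then 1 else 0)"
proof -
  have out: "arm_weight p n j = (if j = i then 1 else 0)" if "E w j" for j
  proof (cases "j \<in> p ` {..n}")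
    case True
    then obtain k where k: "k \<le> n" "j = p k" by auto
    have "k = 0"
    proof (rule ccontr)
      assume "k \<noteq> 0"
      moreover have "E (p k) w" using that k sym by auto
      ultimately have "w = p (k - 1) \<or> (k < n \<and> w = p (Suc k))"
        using assms(1) k unfolding arm_def by (cases "k = n") auto
      then show False using assms(2) k by auto
    qed
    then show ?thesis using k assms by (auto simp: arm_def arm_weight_path)
  next
    case False
    then have "j \<noteq> i" using assms by (auto simp: arm_def)
    then show ?thesis using False by (simp add: arm_weight_def)
  qed
  have "(\<Sum>j | E w j. arm_weight p n j) = (\<Sum>j | E w j. if j = i then 1 else 0)"
    using out by (intro sum.cong) auto
  also have "\<dots> = (if E i w then 1 else 0)" using fin_nbrs sym by (auto simp: sum.delta)
  finally show ?thesis using assms(2) by (simp add: laplace_def arm_weight_def)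
qed

text \<open>Otherwise the sum \<open>g\<close> of the three arm weights, lowered to the value 1 at
  \<open>i\<close>, is subharmonic: \<open>laplace g\<close> equals 1 minus the sum of the
  reciprocals at \<open>i\<close>, and 0 elsewhere.\<close>

lemma three_arms:
  assumes nb: "\<And>w. E i w \<longleftrightarrow> w = a \<or> w = b \<or> w = c" and dist: "distinct [a, b, c]"
    and arms: "arm i a p l" "arm i b q m" "arm i c r n"
  shows "1 < 1 / (real l + 1) + 1 / (real m + 1) + 1 / (real n + 1)"
proof (rule ccontr)
  assume "\<not> ?thesis"
  then have le1: "1 / (real l + 1) + 1 / (real m + 1) + 1 / (real n + 1) \<le> 1" by simp
  let ?pt = "\<lambda>w. if w = i then 1 else (0::real)"
  \<comment> \<open>At \<open>i\<close> the three arm weights add up to 3; subtracting 2 leaves 1.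
    The same subtraction lowers \<open>laplace\<close> by 2 at the neighbours of \<open>i\<close>,
    where the two other arms contribute 1 each.\<close>
  define g where "g w = arm_weight p l w + arm_weight q m w + arm_weight r n w - 2 * ?pt w" for w
  have gp: "gpath p l" "gpath q m" "gpath r n" using arms by (auto simp: arm_def)
  have at_i: "arm_weight p l i = 1" "arm_weight q m i = 1" "arm_weight r n i = 1"
    using arm_weight_path[of p l 0] arm_weight_path[of q m 0] arm_weight_path[of r n 0] arms
    by (auto simp: arm_def)
  have g0: "0 \<le> g w" for w
    using at_i arm_weight_nonneg[OF gp(1), of w] arm_weight_nonneg[OF gp(2), of w]
      arm_weight_nonneg[OF gp(3), of w] by (auto simp: g_def)
  have lap: "laplace g w = laplace (arm_weight p l) w + laplace (arm_weight q m) w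
      + laplace (arm_weight r n) w - 2 * laplace ?pt w" for w
    by (simp add: laplace_def g_def sum.distrib sum_subtractf sum_distrib_left[symmetric] algebra_simps)
  have lpt: "laplace ?pt w = (if E i w then 1 else 0) - 2 * ?pt w" for w
    using fin_nbrs sym by (auto simp: laplace_def sum.delta)
  have sep: "y \<notin> p' ` {..n'}" if "arm i x p' n'" "E i y" "y \<noteq> x" for x y p' n'
  proof
    assume "y \<in> p' ` {..n'}"
    then obtain k where "k \<le> n'" "y = p' k" by auto
    then show False using that gpath_edge_iff[of p' n' 0 k] by (auto simp: arm_def)
  qed
  have on: "laplace (arm_weight p' n') x = 0" if "arm i x p' n'" for x p' n'
    using laplace_arm_weight_on[OF that, of 1] that by (auto simp: arm_def)
  have off: "laplace (arm_weight p' n') y = 1" if "arm i x p' n'" "E i y" "y \<noteq> x" for x y p' n'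
    using laplace_arm_weight_off[OF that(1) sep[OF that]] that by simp
  have far: "laplace (arm_weight p' n') w = 0" if "arm i x p' n'" "\<not> E i w" "w \<noteq> i" for x w p' n'
  proof (cases "w \<in> p' ` {..n'}")
    case True
    then obtain k where "k \<le> n'" "w = p' k" by auto
    then show ?thesis using laplace_arm_weight_on[OF that(1), of k] that by (cases k) (auto simp: arm_def)
  next
    case False
    then show ?thesis using laplace_arm_weight_off[OF that(1)] that by simp
  qed
  have cen: "laplace (arm_weight p' n') i = - 1 - 1 / (real n' + 1)"
    if "arm i x p' n'" "x \<in> {a,b,c}" for x p' n'
  proof -
    have g: "gpath p' n'" "p' 0 = i" "p' 1 = x" "1 \<le> n'" using that by (auto simp: arm_def)
    have "arm_weight p' n' y = (if y = x then 1 - 1 / (real n' + 1) else 0)" if "E i y" for y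
    proof (cases "y = x")
      case True
      then show ?thesis using arm_weight_path[OF g(1), of 1] g by (simp add: add.commute)
    next
      case False
      then show ?thesis using sep[OF \<open>arm i x p' n'\<close> that] by (simp add: arm_weight_def)
    qed
    then have "(\<Sum>j | E i j. arm_weight p' n' j) = (\<Sum>j | E i j. if j = x then 1 - 1 / (real n' + 1) else 0)"
      by (intro sum.cong) auto
    also have "\<dots> = 1 - 1 / (real n' + 1)" using fin_nbrs that nb by (auto simp: sum.delta)
    finally show ?thesis using arm_weight_path[OF g(1), of 0] g by (simp add: laplace_def)
  qed
  have ni: "\<not> E i i" using irrefl .
  have sub: "0 \<le> laplace g w" for w
  proof -
    consider "w = i" | "w \<noteq> i" "\<not> E i w" | "E i w" "w \<noteq> i" by blast
    then show ?thesis
    proof cases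
      case 1
      then show ?thesis unfolding lap lpt
        using cen[OF arms(1)] cen[OF arms(2)] cen[OF arms(3)] ni le1 by simp
    next
      case 2
      then show ?thesis unfolding lap lpt
        using far[OF arms(1)] far[OF arms(2)] far[OF arms(3)] by simp
    next
      case 3
      then consider "w = a" | "w = b" | "w = c" using nb by blast
      then show ?thesis
      proof cases
        case 1
        then show ?thesis unfolding lap lpt
          using on[OF arms(1)] off[OF arms(2), of a] off[OF arms(3), of a] dist 3 by simp
      next
        case 2
        then show ?thesis unfolding lap lpt
          using on[OF arms(2)] off[OF arms(1), of b] off[OF arms(3), of b] dist 3 by auto
      next
        case 3: 3
        then show ?thesis unfolding lap lpt
          using on[OF arms(3)] off[OF arms(1), of c] off[OF arms(2), of c] dist \<open>E i w\<close> \<open>w \<noteq> i\<close> by auto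
      qed
    qed
  qed
  have "i \<in> S" using gpath_in[OF gp(1), of 0] arms by (auto simp: arm_def)
  moreover have "0 < g i" using at_i by (simp add: g_def)
  moreover have "2 * g w \<le> (\<Sum>j | E w j. g j)" for w using sub[of w] by (simp add: laplace_def)
  ultimately show False using no_sub[of g i] g0 by blast
qed

text \<open>A path that starts at a vertex of degree at most one and ends in a leaf is closed under
  neighbours when no degree exceeds two. By connectedness it is everything.\<close>

lemma spanning_path:
  assumes conn: "\<And>x y. x \<in> S \<Longrightarrow> y \<in> S \<Longrightarrow> E\<^sup>*\<^sup>* x y" and ne: "S \<noteq> {}"
    and deg: "\<And>i a b c. E i a \<Longrightarrow> E i b \<Longrightarrow> E i c \<Longrightarrow> distinct [a, b, c] \<Longrightarrow> False"
  obtains p n where "gpath p n" "p ` {..n} = S"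
proof (cases "\<exists>x. S = {x}")
  case True
  then obtain x where "S = {x}" by blast
  then have "x \<in> S" "(\<lambda>_. x) ` {..0::nat} = S" by auto
  moreover from \<open>x \<in> S\<close> have "gpath (\<lambda>_. x) 0" by (simp add: gpath_def)
  ultimately show ?thesis using that by blast
next
  case False
  \<comment> \<open>Some vertex has degree at most one, since otherwise \<open>S\<close> itself
    would contradict \<open>no_min_degree_two\<close>.\<close>
  obtain i where i: "i \<in> S" "\<And>a b. a \<in> S \<Longrightarrow> b \<in> S \<Longrightarrow> E i a \<Longrightarrow> E i b \<Longrightarrow> a = b"
    using no_min_degree_two[of S] ne by blast
  obtain y where y: "y \<in> S" "y \<noteq> i" using False i by blast
  have "E\<^sup>*\<^sup>* i y" using conn i y by blast
  then obtain a where a: "E i a" using y by (metis converse_rtranclpE)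
  obtain p n where p: "1 \<le> n" "gpath p n" "p 0 = i" "p 1 = a" "\<And>w. E (p n) w \<longleftrightarrow> w = p (n - 1)"
    using path_to_leaf[OF a] by metis
  have cl: "u \<in> p ` {..n}" if "w \<in> p ` {..n}" "E w u" for w u
  proof -
    obtain k where k: "k \<le> n" "w = p k" using \<open>w \<in> p ` {..n}\<close> by auto
    consider "k = 0" | "k = n" "0 < k" | "0 < k" "k < n" using k by linarith
    then show ?thesis
    proof cases
      case 1
      then have "u = a" using i(2)[of u a] a that k p E_in2 by auto
      then show ?thesis using p by force
    next
      case 2
      then show ?thesis using p(5) that k by auto
    next
      case 3
      have "E (p k) (p (k - 1))" "E (p k) (p (Suc k))" using gpath_edge_iff[OF p(2)] 3 by auto
      moreover have "p (k - 1) \<noteq> p (Suc k)" using gpath_eq[OF p(2)] 3 by auto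
      ultimately have "u = p (k - 1) \<or> u = p (Suc k)"
        using deg[of "p k" "p (k - 1)" "p (Suc k)" u] that k by auto
      then show ?thesis using 3 by auto
    qed
  qed
  have "u \<in> p ` {..n}" if "E\<^sup>*\<^sup>* i u" for u
    using that
  proof (induction rule: rtranclp_induct)
    case base
    then show ?case using p by force
  next
    case (step w u)
    then show ?case using cl by blast
  qed
  then have "S \<subseteq> p ` {..n}" using conn i by blast
  moreover have "p ` {..n} \<subseteq> S" using gpath_in[OF p(2)] by auto
  ultimately show ?thesis using that p by blast
qed

end

section \<open>Excluding branch vertices\<close>

text \<open>The remaining case of \<open>arm_arithmetic\<close>, with third step
  \<open>z / k\<close>. The equations determine \<open>z = k * N / D\<close>, and
  \<open>z < 1\<close> forces \<open>k < D\<close>, which leaves few triples of arm lengths.\<close>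

lemma arm_arithmetic_chain:
  fixes z s t :: real and m n k q r :: int
  assumes n: "2 \<le> m" "2 \<le> n" "2 \<le> k" and z: "0 < z" "z < 1"
    and s: "m * s = z + q" "z < s" "s < 1" and t: "n * t = z + r" "z < t" "t < 1"
    and sum: "s + t + z / k = 1 + z" and inv: "1 < 1 / m + 1 / n + 1 / real_of_int k"
  shows False
proof -
  define N where "N = m * n - q * n - r * m"
  define D where "D = n * k + m * k + m * n - m * n * k"
  have pos: "0 < real_of_int m" "0 < real_of_int n" "0 < real_of_int k" using n by simp_all
  have "real_of_int D = (1 / m + 1 / n + 1 / k - 1) * (m * n * k)"
    using pos by (simp add: D_def field_simps)
  then have D0: "0 < D" using inv pos
    by (metis (no_types, opaque_lifting) diff_gt_0_iff_gt mult_pos_pos of_int_0_less_iff)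
  have zD: "z * D = k * N"
  proof -
    have "s = (z + q) / m" "t = (z + r) / n" using s t pos by (simp_all add: field_simps)
    then have "(z + q) / m + (z + r) / n + z / k = 1 + z" using sum by simp
    then have "((z + q) / m + (z + r) / n + z / k) * (m * n * k) = (1 + z) * (m * n * k)" by simp
    moreover have "((z + q) / m + (z + r) / n + z / k) * (m * n * k)
        = (z + q) * n * k + (z + r) * m * k + z * m * n" using pos by (simp add: field_simps)
    ultimately show ?thesis by (simp add: D_def N_def algebra_simps)
  qed
  have N1: "1 \<le> N"
  proof -
    have "0 < real_of_int k * N" using zD[symmetric] z D0 by simp
    then show ?thesis using pos by (simp add: zero_less_mult_iff)
  qed
  have kN: "k * N < D"
  proof -
    have "real_of_int (k * N) < D" using zD z D0 mult_strict_right_mono[of z 1 D] by simp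
    then show ?thesis by linarith
  qed
  moreover have "k * 1 \<le> k * N" using N1 n by (intro mult_left_mono) auto
  ultimately have kD: "k < D" by simp
  have q1: "1 \<le> q" using s(1,2) z n(1) pos mult_right_mono[of 1 m s] by simp
  have r1: "1 \<le> r" using t(1,2) z n(2) pos mult_right_mono[of 1 n t] by simp
  \<comment> \<open>With one length equal to 2 the corresponding integer is 1. The case
    \<open>k = 2\<close> then leads to \<open>t = z\<close>, and \<open>k = 3\<close> fails because
    \<open>N\<close> would be both 1 and even.\<close>
  have special: "False" if n: "2 \<le> n" and 2: "m = 2" and s: "2 * s = z + q" "s < 1" "1 \<le> q"
    and t: "n * t = z + r" "z < t" and N: "N = m * n - q * n - r * m"
    and D: "D = n * k + m * k + m * n - m * n * k" for m n q r :: int and s t :: real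
  proof -
    have "q = 1" using s z by linarith
    then have Neq: "N = n - 2 * r" using N 2 by simp
    have Deq: "D = 4 - (k - 2) * (n - 2)" using D 2 by (simp add: algebra_simps)
    have nn: "0 \<le> (k - 2) * (n - 2)" using n \<open>2 \<le> k\<close> by simp
    show False
    proof (cases "k = 2")
      case True
      then have "N = 1" "D = 4" using Deq kN N1 by auto
      then have "z = 1 / 2" using zD True by simp
      moreover have "n = 2 * r + 1" using Neq \<open>N = 1\<close> by simp
      ultimately have "z + r = n * z" by (simp add: algebra_simps)
      then have "n * t = n * z" using t by simp
      then show False using t n by simp
    next
      case False
      then have "k = 3" using Deq nn kD \<open>2 \<le> k\<close> by linarith
      then have "n = 2" "N = 1" using Deq kD kN n N1 by auto
      then show False using Neq by presburger
    qed
  qed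
  consider "m = 2" | "n = 2" | "3 \<le> m" "3 \<le> n" "k = 2" | "3 \<le> m" "3 \<le> n" "3 \<le> k"
    using n by linarith
  then show False
  proof cases
    case 1
    then show False using special[of n m s q t r] n s t q1 by (simp add: N_def D_def)
  next
    case 2
    then show False using special[of m n t r s q] n s t r1 by (simp add: N_def D_def algebra_simps)
  next
    case 3
    have Deq: "D = 4 - (m - 2) * (n - 2)" using 3 by (simp add: D_def algebra_simps)
    have "0 \<le> (m - 2) * (n - 2)" using 3 by simp
    moreover have "2 * N < D" using kN 3 by simp
    ultimately have N: "N = 1" using N1 Deq by linarith
    have lt: "(m - 2) * (n - 2) < 2" using kN N 3 Deq by simp
    have "(m - 2) * 1 \<le> (m - 2) * (n - 2)" "1 * (n - 2) \<le> (m - 2) * (n - 2)"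
      using 3 by (intro mult_left_mono mult_right_mono; simp)+
    then have "m - 2 < 2" "n - 2 < 2" using lt by simp_all
    then have "m = 3" "n = 3" using 3 by simp_all
    \<comment> \<open>Impossible modulo 3.\<close>
    then have "9 - 3 * q - 3 * r = 1" using N by (simp add: N_def)
    then show False by presburger
  next
    case 4
    have "1 / real_of_int m \<le> 1 / 3" "1 / real_of_int n \<le> 1 / 3" "1 / real_of_int k \<le> 1 / 3"
      using 4 by (simp_all add: frac_le)
    then show False using inv by linarith
  qed
qed

text \<open>To be applied at a branch vertex with arm lengths \<open>m\<close>, \<open>n\<close>,
  \<open>k\<close> that count the branch vertex, and steps \<open>s\<close>, \<open>t\<close>,
  \<open>u\<close>. If all three integers are at least 1, each reciprocal length is at most the step
  divided by \<open>1 + z\<close>, and these quotients add up to 1. Only the third integer can be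
  0.\<close>

lemma arm_arithmetic:
  fixes z s t u :: real and m n k q r j :: int
  assumes n: "2 \<le> m" "2 \<le> n" "2 \<le> k" and z: "0 < z" "z < 1"
    and s: "m * s = z + q" "z < s" "s < 1" and t: "n * t = z + r" "z < t" "t < 1"
    and u: "k * u = z + j" "0 < u"
    and sum: "s + t + u = 1 + z" and inv: "1 < 1 / m + 1 / n + 1 / real_of_int k"
  shows False
proof -
  have pos: "0 < real_of_int m" "0 < real_of_int n" "0 < real_of_int k" using n by simp_all
  have "0 < k * u" using u(2) pos(3) by (rule mult_pos_pos[rotated])
  then have "0 \<le> j" using u z by linarith
  show False
  proof (cases "j = 0")
    case True
    then have "u = z / k" using u pos by (simp add: field_simps)
    then show False using arm_arithmetic_chain[of m n k z s q t r] assms by blast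
  next
    case False
    have q1: "1 \<le> q" using s(1,2) z n(1) pos mult_right_mono[of 1 m s] by simp
    have r1: "1 \<le> r" using t(1,2) z n(2) pos mult_right_mono[of 1 n t] by simp
    have le: "1 / real_of_int x \<le> y / (1 + z)" if "x * y = z + i" "1 \<le> i" "2 \<le> x" for x i :: int and y :: real
      using that z by (simp add: field_simps)
    have "1 / m + 1 / n + 1 / real_of_int k \<le> s / (1 + z) + t / (1 + z) + u / (1 + z)"
      using le[OF s(1) q1 n(1)] le[OF t(1) r1 n(2)] le[OF u(1) _ n(3)] \<open>0 \<le> j\<close> False by simp
    also have "\<dots> = 1" using sum z by (simp add: add_divide_distrib[symmetric])
    finally show False using inv by simp
  qed
qed

sublocale ascent_free_poset \<subseteq> dynkin_graph S "hasse_edge S le"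
proof unfold_locales
  show "finite S" by (rule fin)
  show "x \<in> S" if "hasse_edge S le x y" for x y using hasse_edge_in that by metis
  show False if "\<And>i. i \<in> S \<Longrightarrow> 0 \<le> (g i :: real)" "a \<in> S" "0 < g a"
    "\<And>i. i \<in> S \<Longrightarrow> 0 < g i \<Longrightarrow> 2 * g i \<le> (\<Sum>j | hasse_edge S le i j. g j)" for g a
    using no_subharmonic[of g a] that by blast
qed (auto intro: hasse_edge_sym simp: hasse_edge_irrefl)

context ascent_free_poset
begin

section \<open>Arithmetic progressions along paths\<close>

abbreviation y :: "'a \<Rightarrow> real" where "y \<equiv> up_sum S le v"
abbreviation z :: "'a \<Rightarrow> real" where "z \<equiv> down_sum S le v"

lemma y_plus_z: "i \<in> S \<Longrightarrow> y i + z i = 1"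
  using grad_v by (simp add: grad_def)

lemma y_pos:
  assumes "i \<in> S"
  shows "0 < y i"
proof -
  have "v i \<le> y i"
    unfolding up_sum_def
    using member_le_sum[of i S "\<lambda>k. if le i k then v k else 0"] refl[OF assms] assms fin v_pos
    by (simp add: less_imp_le)
  then show ?thesis using v_pos[OF assms] by simp
qed

lemma z_pos: "i \<in> S \<Longrightarrow> 0 < z i"
proof -
  interpret d: ascent_free_poset S "\<lambda>x y. le y x" v by (rule dual)
  show "i \<in> S \<Longrightarrow> 0 < z i" by (rule d.y_pos)
qed

lemma v_down_sum:
  assumes "i \<in> S"
  shows "v i = z i - (\<Sum>j | covers S le j i. z j)"
proof -
  interpret d: ascent_free_poset S "\<lambda>x y. le y x" v by (rule dual)
  show ?thesis using d.v_up_sum[OF assms] unfolding covers_dual[of S le] .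
qed

text \<open>By \<open>v_up_sum\<close>, \<open>y i\<close> exceeds the sum of \<open>y\<close> over
  the upper covers of \<open>i\<close> by the positive number \<open>v i\<close>.\<close>

lemma y_less:
  assumes "covers S le i j"
  shows "y j < y i"
proof -
  have "y j \<le> (\<Sum>k | covers S le i k. y k)"
    by (rule member_le_sum) (use finite_covers assms y_pos covers_in in \<open>auto intro: less_imp_le\<close>)
  then show ?thesis using v_up_sum[of i] v_pos[of i] covers_in[OF assms] by simp
qed

text \<open>The fractional part of \<open>z i - z j\<close> across an edge; by \<open>sum_step\<close> it does not change along
  a path of vertices of degree two.\<close>

definition step :: "'a \<Rightarrow> 'a \<Rightarrow> real" where
  "step i j = (if covers S le i j then 1 + z i - z j else z i - z j)"

lemma step_bounds:
  assumes "hasse_edge S le i j"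
  shows "0 < step i j" "step i j < 1"
proof -
  have ij: "i \<in> S" "j \<in> S" using hasse_edge_in[OF assms] by auto
  have b: "0 < z i" "z i < 1" "0 < z j" "z j < 1"
    using z_pos y_pos y_plus_z[of i] y_plus_z[of j] ij by (auto, smt (verit), smt (verit))
  show "0 < step i j" "step i j < 1"
    using assms b y_less[of i j] y_less[of j i] y_plus_z[OF ij(1)] y_plus_z[OF ij(2)]
    by (auto simp: step_def hasse_edge_def)
qed

lemma step_up:
  assumes "covers S le i j"
  shows "z i < step i j"
  using assms y_pos[of j] y_plus_z[of j] covers_in[OF assms] by (simp add: step_def)

lemma step_swap: "hasse_edge S le i j \<Longrightarrow> step j i = 1 - step i j"
  using covers_asym by (auto simp: step_def hasse_edge_def)

lemma step_diff_Ints: "z i - z j - step i j \<in> \<int>"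
  by (simp add: step_def)

text \<open>An upper cover \<open>j\<close> contributes \<open>z i + y j\<close>, a lower cover
  \<open>z i - z j\<close>. The sums of \<open>y\<close> and \<open>z\<close> over the covers are
  \<open>y i - v i\<close> and \<open>z i - v i\<close>, so \<open>v i\<close> cancels and
  \<open>y i + z i = 1\<close> finishes.\<close>

lemma sum_step:
  assumes "i \<in> S"
  shows "(\<Sum>j | hasse_edge S le i j. step i j) = 1 + (real (card {j. hasse_edge S le i j}) - 2) * z i"
proof -
  let ?U = "{j. covers S le i j}" and ?D = "{j. covers S le j i}"
  have cD: "(\<Sum>j\<in>?D. step i j) = real (card ?D) * z i - (\<Sum>j\<in>?D. z j)"
  proof -
    have "(\<Sum>j\<in>?D. step i j) = (\<Sum>j\<in>?D. z i - z j)"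
      using covers_asym by (intro sum.cong) (auto simp: step_def)
    then show ?thesis by (simp add: sum_subtractf)
  qed
  have cU: "(\<Sum>j\<in>?U. step i j) = real (card ?U) * z i + (\<Sum>j\<in>?U. y j)"
  proof -
    have "(\<Sum>j\<in>?U. step i j) = (\<Sum>j\<in>?U. z i + y j)"
      using y_plus_z covers_in by (intro sum.cong) (auto simp: step_def, smt (verit))
    then show ?thesis by (simp add: sum.distrib)
  qed
  have "card {j. hasse_edge S le i j} = card ?U + card ?D"
  proof -
    have "{j. hasse_edge S le i j} = ?U \<union> ?D" by (auto simp: hasse_edge_def)
    moreover have "?U \<inter> ?D = {}" using covers_asym by blast
    ultimately show ?thesis using finite_covers by (simp add: card_Un_disjoint)
  qed
  then show ?thesis
    using sum_hasse_edge[of "step i" i] cD cU v_up_sum[OF assms] v_down_sum[OF assms] y_plus_z[OF assms]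
    by (simp add: algebra_simps)
qed

lemma step_leaf:
  assumes "\<And>w. hasse_edge S le i w \<longleftrightarrow> w = j"
  shows "step j i = z i"
proof -
  have e: "hasse_edge S le i j" using assms by simp
  have "{w. hasse_edge S le i w} = {j}" using assms by auto
  then have "step i j = 1 - z i" using sum_step[of i] hasse_edge_in[OF e] by simp
  then show ?thesis using step_swap[OF e] by simp
qed

text \<open>At degree two the outgoing steps add up to 1, and reversing an edge replaces its step by
  the complement to 1.\<close>

lemma step_inner:
  assumes "\<And>w. hasse_edge S le i w \<longleftrightarrow> w = j \<or> w = k" "j \<noteq> k"
  shows "step i k = step j i"
proof -
  have e: "hasse_edge S le i j" using assms by simp
  have "{w. hasse_edge S le i w} = {j, k}" using assms by auto
  then have "step i j + step i k = 1" using sum_step[of i] hasse_edge_in[OF e] assms by simp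
  then show ?thesis using step_swap[OF e] by simp
qed

lemma step_path_const:
  assumes p: "gpath p n"
    and inner: "\<And>k w. 0 < k \<Longrightarrow> k < n \<Longrightarrow> hasse_edge S le (p k) w \<longleftrightarrow> w = p (k - 1) \<or> w = p (Suc k)"
    and "k < n"
  shows "step (p k) (p (Suc k)) = step (p 0) (p 1)"
  using \<open>k < n\<close>
proof (induction k)
  case (Suc k)
  have "p k \<noteq> p (Suc (Suc k))" using gpath_eq[OF p] Suc by auto
  then have "step (p (Suc k)) (p (Suc (Suc k))) = step (p k) (p (Suc k))"
    using inner[of "Suc k"] Suc.prems by (intro step_inner) auto
  then show ?case using Suc by simp
qed simp

lemma step_path_Ints:
  assumes "gpath p n"
    and "\<And>k w. 0 < k \<Longrightarrow> k < n \<Longrightarrow> hasse_edge S le (p k) w \<longleftrightarrow> w = p (k - 1) \<or> w = p (Suc k)"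
    and "k \<le> n"
  shows "z (p 0) - z (p k) - k * step (p 0) (p 1) \<in> \<int>"
  using \<open>k \<le> n\<close>
proof (induction k)
  case (Suc k)
  have eq: "z (p 0) - z (p (Suc k)) - Suc k * step (p 0) (p 1) =
      (z (p 0) - z (p k) - k * step (p 0) (p 1)) + (z (p k) - z (p (Suc k)) - step (p k) (p (Suc k)))"
    using step_path_const[OF assms(1,2), of k] Suc.prems by (simp add: algebra_simps)
  have "z (p 0) - z (p k) - k * step (p 0) (p 1) \<in> \<int>" using Suc by simp
  then show ?case unfolding eq using step_diff_Ints by (rule Ints_add)
qed simp

text \<open>The \<open>n\<close> edges change \<open>z\<close> by \<open>n\<close> equal steps
  modulo 1, and \<open>z\<close> at the leaf is one more step.\<close>

lemma arm_step:
  assumes "arm i a p n"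
  obtains q :: int where "int (n + 1) * step i a = z i + q"
proof -
  have p: "gpath p n" "1 \<le> n" "p 0 = i" "p 1 = a" "\<And>w. hasse_edge S le (p n) w \<longleftrightarrow> w = p (n - 1)"
    "\<And>k w. 0 < k \<Longrightarrow> k < n \<Longrightarrow> hasse_edge S le (p k) w \<longleftrightarrow> w = p (k - 1) \<or> w = p (Suc k)"
    using assms by (auto simp: arm_def)
  have "step (p (n - 1)) (p n) = z (p n)" by (rule step_leaf) (rule p(5))
  then have "z (p n) = step i a" using step_path_const[OF p(1,6), of "n - 1"] p(2-4) by simp
  moreover have "z i - z (p n) - n * step i a \<in> \<int>" using step_path_Ints[OF p(1,6), of n] p(3,4) by simp
  ultimately have "z i - (real n + 1) * step i a \<in> \<int>" by (simp add: algebra_simps)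
  then obtain k where "z i - (real n + 1) * step i a = of_int k" by (auto elim: Ints_cases)
  then show ?thesis using that[of "- k"] by (simp add: algebra_simps)
qed

text \<open>Steps to upper covers exceed \<open>z i\<close>, so \<open>a\<close> and
  \<open>b\<close> supply the strict lower bounds of \<open>arm_arithmetic\<close>;
  \<open>sum_step\<close> at degree three supplies the sum \<open>1 + z i\<close>.\<close>

lemma no_branch_two_up:
  assumes "covers S le i a" "covers S le i b" "hasse_edge S le i c" "distinct [a, b, c]"
  shows False
proof -
  have e: "hasse_edge S le i a" "hasse_edge S le i b" using assms by (auto simp: hasse_edge_def)
  have iS: "i \<in> S" using hasse_edge_in[OF e(1)] by simp
  have nb: "hasse_edge S le i w \<longleftrightarrow> w = a \<or> w = b \<or> w = c" for w
    using degree_le_three[of i a b c w] e assms(3,4) by auto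
  obtain p l where p: "arm i a p l" using arm_exists[of i a b c] e assms by auto
  obtain q m where q: "arm i b q m" using arm_exists[of i b a c] e assms by auto
  obtain r n where r: "arm i c r n" using arm_exists[of i c a b] e assms by auto
  have inv: "1 < 1 / (real l + 1) + 1 / (real m + 1) + 1 / (real n + 1)"
    using three_arms[OF nb assms(4) p q r] .
  obtain Q where Q: "int (l + 1) * step i a = z i + real_of_int Q" using arm_step[OF p] .
  obtain R where R: "int (m + 1) * step i b = z i + real_of_int R" using arm_step[OF q] .
  obtain J where J: "int (n + 1) * step i c = z i + real_of_int J" using arm_step[OF r] .
  have sz: "2 \<le> int (l + 1)" "2 \<le> int (m + 1)" "2 \<le> int (n + 1)" using p q r by (auto simp: arm_def)
  have "{w. hasse_edge S le i w} = {a, b, c}" using nb by auto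
  then have "step i a + step i b + step i c = 1 + z i" using sum_step[OF iS] assms(4) by simp
  moreover have "z i < 1" using y_pos[OF iS] y_plus_z[OF iS] by simp
  ultimately show False
    using arm_arithmetic[OF sz z_pos[OF iS] _ Q _ _ R _ _ J]
      step_bounds[OF e(1)] step_bounds[OF e(2)] step_bounds[OF assms(3)]
      step_up[OF assms(1)] step_up[OF assms(2)] inv by (simp add: add.commute)
qed

text \<open>Two of the three neighbours lie on the same side of \<open>i\<close>; the case of two
  lower covers is dual.\<close>

lemma no_branch_vertex:
  assumes "hasse_edge S le i a" "hasse_edge S le i b" "hasse_edge S le i c" "distinct [a, b, c]"
  shows False
proof -
  interpret d: ascent_free_poset S "\<lambda>x y. le y x" v by (rule dual)
  have down: False if "covers S le a i" "covers S le b i" "hasse_edge S le i c" "distinct [a, b, c]" for a b c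
    using d.no_branch_two_up[of i a b c] that unfolding covers_dual[of S le] hasse_edge_dual[of S le] by blast
  have up: "covers S le i x \<or> covers S le x i" if "hasse_edge S le i x" for x
    using that by (simp add: hasse_edge_def)
  consider "covers S le i a \<and> covers S le i b \<or> covers S le a i \<and> covers S le b i"
    | "covers S le i a \<and> covers S le i c \<or> covers S le a i \<and> covers S le c i"
    | "covers S le i b \<and> covers S le i c \<or> covers S le b i \<and> covers S le c i"
    using up assms by blast
  then show False
  proof cases
    case 1
    then show False using no_branch_two_up[of i a b c] down[of a b c] assms by blast
  next
    case 2
    then show False using no_branch_two_up[of i a c b] down[of a c b] assms by auto
  next
    case 3
    then show False using no_branch_two_up[of i b c a] down[of b c a] assms by auto
  qed
qed

end

section \<open>Path posets as sequences\<close>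

text \<open>Vertex \<open>k\<close> of the path lies in the chain number \<open>blk M t k\<close>, the integer part of \<open>k t / M\<close>;
  each chain is numbered from its top downwards.\<close>

definition blk :: "nat \<Rightarrow> nat \<Rightarrow> nat \<Rightarrow> nat" where
  "blk M t k = k * t div M"

text \<open>Within a block larger indices are lower, so the first clause reverses the indices. The
  second joins the last index of a block, its minimum, to the first index of the next, its
  maximum.\<close>

definition seq_le :: "nat \<Rightarrow> nat \<Rightarrow> nat \<Rightarrow> nat \<Rightarrow> bool" where
  "seq_le M t a b \<longleftrightarrow> blk M t a = blk M t b \<and> b \<le> a \<or> b = Suc a \<and> blk M t b = Suc (blk M t a)"

lemma blk_mono: "a \<le> b \<Longrightarrow> blk M t a \<le> blk M t b"
  by (simp add: blk_def div_le_mono)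

text \<open>Advancing twice adds at most \<open>M\<close> to the numerator, so two consecutive steps
  never both change the block.\<close>

lemma blk_Suc_Suc:
  assumes "2 * t \<le> M" "0 < M"
  shows "blk M t (Suc (Suc k)) \<le> Suc (blk M t k)"
proof -
  have "Suc (Suc k) * t \<le> k * t + M" using assms by simp
  then have "Suc (Suc k) * t div M \<le> (k * t + M) div M" by (rule div_le_mono)
  then show ?thesis using assms by (simp add: blk_def)
qed

lemma blk_Suc:
  assumes "2 * t \<le> M" "0 < M"
  shows "blk M t (Suc k) = blk M t k \<or> blk M t (Suc k) = Suc (blk M t k)"
  using blk_Suc_Suc[OF assms, of k] blk_mono[of "Suc k" "Suc (Suc k)" M t] blk_mono[of k "Suc k" M t] by linarith

context ascent_free_poset
begin

section \<open>Coordinates on a path poset\<close>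

lemma le_imp_covers_rtranclp:
  assumes "i \<in> S" "k \<in> S" "le i k"
  shows "(covers S le)\<^sup>*\<^sup>* i k"
  using assms(2,3)
proof (induction "card {l \<in> S. le l k}" arbitrary: k rule: less_induct)
  case less
  show ?case
  proof (cases "i = k")
    case False
    then obtain j where j: "j \<in> S" "le i j" "covers S le j k"
      using lower_cover_exists[of i k] less.prems assms by blast
    have jk: "le j k" "j \<noteq> k" using j by (auto simp: covers_def pless_def)
    have "{l \<in> S. le l j} \<subset> {l \<in> S. le l k}"
    proof
      show "{l \<in> S. le l j} \<subseteq> {l \<in> S. le l k}" using trans[of _ j k] j jk less.prems by blast
      have "k \<in> {l \<in> S. le l k}" "k \<notin> {l \<in> S. le l j}"
        using refl[of k] antisym[of j k] j jk less.prems by blast+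
      then show "{l \<in> S. le l j} \<noteq> {l \<in> S. le l k}" by blast
    qed
    then have "card {l \<in> S. le l j} < card {l \<in> S. le l k}" using fin by (intro psubset_card_mono) auto
    then have "(covers S le)\<^sup>*\<^sup>* i j" using less.hyps j by blast
    then show ?thesis using j by (simp add: rtranclp.rtrancl_into_rtrancl)
  qed simp
qed

text \<open>Numbering from 1 extends the progression to imaginary vertices 0 and \<open>M\<close>,
  where it is integral; hence \<open>real M * \<delta> \<in> \<int>\<close>.\<close>

lemma path_progression:
  assumes conn: "hasse_connected S le"
  obtains p :: "nat \<Rightarrow> 'a" and M :: nat and \<delta> :: real where "2 \<le> M" "bij_betw p {1..<M} S" "0 < \<delta>" "\<delta> < 1" "real M * \<delta> \<in> \<int>"
    "\<And>k. k \<in> {1..<M} \<Longrightarrow> y (p k) - k * \<delta> \<in> \<int>"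
    "\<And>i k. i \<in> {1..<M} \<Longrightarrow> k \<in> {1..<M} \<Longrightarrow> hasse_edge S le (p i) (p k) \<longleftrightarrow> k = Suc i \<or> i = Suc k"
proof -
  obtain p n where p: "gpath p n" "p ` {..n} = S"
    using spanning_path conn no_branch_vertex unfolding hasse_connected_def by metis
  have edge: "hasse_edge S le (p i) (p k) \<longleftrightarrow> k = Suc i \<or> i = Suc k" if "i \<le> n" "k \<le> n" for i k
    using gpath_edge_iff[OF p(1)] that .
  have nbr: "hasse_edge S le (p i) w \<longleftrightarrow> (\<exists>k\<le>n. w = p k \<and> (k = Suc i \<or> i = Suc k))" if "i \<le> n" for i w
  proof
    assume *: "hasse_edge S le (p i) w"
    then obtain k where "k \<le> n" "w = p k" using hasse_edge_in p(2) by fastforce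
    then show "\<exists>k\<le>n. w = p k \<and> (k = Suc i \<or> i = Suc k)" using edge[OF that] * by blast
  qed (use edge that in blast)
  have inner: "hasse_edge S le (p k) w \<longleftrightarrow> w = p (k - 1) \<or> w = p (Suc k)" if "0 < k" "k < n" for k w
    using nbr[of k w] that by (auto intro: exI[of _ "k - 1"] exI[of _ "Suc k"])
  define \<delta> where "\<delta> = y (p 0)"
  have inS: "p k \<in> S" if "k \<le> n" for k using gpath_in[OF p(1) that] .
  have \<delta>: "0 < \<delta>" "\<delta> < 1" using y_pos z_pos y_plus_z inS[of 0] unfolding \<delta>_def by (auto, smt (verit))
  have all: "real (n + 2) * \<delta> \<in> \<int> \<and> (\<forall>k\<le>n. y (p k) - (real k + 1) * \<delta> \<in> \<int>)"
  \<comment> \<open>A single vertex has no edge to supply a step; there \<open>sum_step\<close> at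
    degree zero gives \<delta> = 1/2.\<close>
  proof (cases "n = 0")
    case True
    have "{w. hasse_edge S le (p 0) w} = {}" using nbr[of 0] True by auto
    then have "1 - 2 * z (p 0) = 0" using sum_step[of "p 0"] inS[of 0] by simp
    then have "\<delta> = 1 / 2" using y_plus_z[of "p 0"] inS[of 0] by (simp add: \<delta>_def)
    then have "real (n + 2) * \<delta> = 1" using True by simp
    moreover have "y (p k) - (real k + 1) * \<delta> = 0" if "k \<le> n" for k using True that by (simp add: \<delta>_def)
    ultimately show ?thesis by simp
  next
    case False
    have "hasse_edge S le (p 0) w \<longleftrightarrow> w = p 1" for w using nbr[of 0 w] False by auto
    then have "step (p 1) (p 0) = z (p 0)" by (rule step_leaf)
    moreover have "hasse_edge S le (p 0) (p 1)" using edge[of 0 1] False by auto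
    ultimately have st: "step (p 0) (p 1) = \<delta>"
      using step_swap[of "p 0" "p 1"] y_plus_z[of "p 0"] inS[of 0] by (simp add: \<delta>_def)
    have prog: "y (p k) - (real k + 1) * \<delta> \<in> \<int>" if "k \<le> n" for k
    proof -
      have "y (p k) - (real k + 1) * \<delta> = z (p 0) - z (p k) - k * \<delta>"
        using y_plus_z[of "p 0"] y_plus_z[of "p k"] inS that by (simp add: \<delta>_def algebra_simps)
      moreover have "z (p 0) - z (p k) - k * \<delta> \<in> \<int>"
        using step_path_Ints[OF p(1) inner that] unfolding st by simp
      ultimately show ?thesis by (simp only:)
    qed
    have "hasse_edge S le (p n) w \<longleftrightarrow> w = p (n - 1)" for w
      using nbr[of n w] False by (auto intro: exI[of _ "n - 1"])
    then have "step (p (n - 1)) (p n) = z (p n)" by (rule step_leaf)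
    moreover have "step (p (n - 1)) (p n) = \<delta>"
      using step_path_const[OF p(1) inner, of "n - 1"] False st by simp
    \<comment> \<open>The last step equals \<delta> and, ending in a leaf, also equals
      \<open>z (p n)\<close>. Comparing with the progression at \<open>p n\<close> makes
      \<open>(n + 2) * \<delta>\<close> integral.\<close>
    ultimately have "y (p n) = 1 - \<delta>" using y_plus_z[of "p n"] inS by simp
    then have "(1 - \<delta>) - (real n + 1) * \<delta> \<in> \<int>" using prog[of n] by (simp only:)
    then have "1 - ((1 - \<delta>) - (real n + 1) * \<delta>) \<in> \<int>" by (rule Ints_diff[OF Ints_1])
    then have "real (n + 2) * \<delta> \<in> \<int>" by (simp add: algebra_simps)
    then show ?thesis using prog by blast
  qed
  have "bij_betw (\<lambda>k. p (k - 1)) {1..<n+2} S"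
  proof (rule bij_betw_imageI)
    show "inj_on (\<lambda>k. p (k - 1)) {1..<n+2}" using gpath_eq[OF p(1)] by (auto simp: inj_on_def)
    have "(\<lambda>k. k - 1) ` {1..<n+2} = {..n}"
    proof
      show "{..n} \<subseteq> (\<lambda>k. k - 1) ` {1..<n+2}"
      proof
        fix k assume "k \<in> {..n}"
        then show "k \<in> (\<lambda>k. k - 1) ` {1..<n+2}" by (intro image_eqI[of _ _ "Suc k"]) auto
      qed
    qed auto
    then show "(\<lambda>k. p (k - 1)) ` {1..<n+2} = S" using p(2) by (metis image_image)
  qed
  moreover have "y (p (k - 1)) - k * \<delta> \<in> \<int>" if "k \<in> {1..<n+2}" for k
  proof -
    have "k - 1 \<le> n" using that by auto
    then have "y (p (k - 1)) - (real (k - 1) + 1) * \<delta> \<in> \<int>" using all by simp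
    then show ?thesis using that by (simp add: of_nat_diff)
  qed
  moreover have "hasse_edge S le (p (i - 1)) (p (k - 1)) \<longleftrightarrow> k = Suc i \<or> i = Suc k"
    if "i \<in> {1..<n+2}" "k \<in> {1..<n+2}" for i k
  proof -
    have "i - 1 \<le> n" "k - 1 \<le> n" using that by auto
    then have "hasse_edge S le (p (i - 1)) (p (k - 1)) \<longleftrightarrow> k - 1 = Suc (i - 1) \<or> i - 1 = Suc (k - 1)"
      by (rule edge)
    then show ?thesis using that by auto
  qed
  ultimately show ?thesis using that[of "n + 2" "\<lambda>k. p (k - 1)" \<delta>] \<delta> all by auto
qed

text \<open>Traversing the path backwards replaces \<delta> by 1 - \<delta>.\<close>

lemma path_progression_half:
  assumes conn: "hasse_connected S le"
  obtains p :: "nat \<Rightarrow> 'a" and M :: nat and \<delta> :: real where "2 \<le> M" "bij_betw p {1..<M} S" "0 < \<delta>" "\<delta> \<le> 1 / 2" "real M * \<delta> \<in> \<int>"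
    "\<And>k. k \<in> {1..<M} \<Longrightarrow> y (p k) - k * \<delta> \<in> \<int>"
    "\<And>i k. i \<in> {1..<M} \<Longrightarrow> k \<in> {1..<M} \<Longrightarrow> hasse_edge S le (p i) (p k) \<longleftrightarrow> k = Suc i \<or> i = Suc k"
proof -
  obtain p :: "nat \<Rightarrow> 'a" and M :: nat and \<delta> :: real where p: "2 \<le> M" "bij_betw p {1..<M} S" "0 < \<delta>" "\<delta> < 1" "real M * \<delta> \<in> \<int>"
    "\<And>k. k \<in> {1..<M} \<Longrightarrow> y (p k) - k * \<delta> \<in> \<int>"
    "\<And>i k. i \<in> {1..<M} \<Longrightarrow> k \<in> {1..<M} \<Longrightarrow> hasse_edge S le (p i) (p k) \<longleftrightarrow> k = Suc i \<or> i = Suc k"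
    using path_progression[OF conn] by metis
  show ?thesis
  proof (cases "\<delta> \<le> 1 / 2")
    case True
    then show ?thesis using that p by blast
  next
    case False
    let ?p = "\<lambda>k. p (M - k)"
    have "bij_betw (\<lambda>k. M - k) {1..<M} {1..<M}"
      by (rule bij_betw_byWitness[where f' = "\<lambda>k. M - k"]) auto
    then have "bij_betw ?p {1..<M} S" using bij_betw_trans[OF _ p(2)] by (simp add: o_def)
    moreover have "real M * (1 - \<delta>) \<in> \<int>" using p(5) by (simp add: algebra_simps)
    moreover have "y (?p k) - k * (1 - \<delta>) \<in> \<int>" if "k \<in> {1..<M}" for k
    proof -
      have "M - k \<in> {1..<M}" using that by auto
      then have "y (?p k) - real (M - k) * \<delta> \<in> \<int>" by (rule p(6))
      then have "(y (?p k) - real (M - k) * \<delta>) + real M * \<delta> - k \<in> \<int>"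
        by (intro Ints_diff[OF Ints_add[OF _ p(5)]]) auto
      then show ?thesis using that by (simp add: of_nat_diff algebra_simps)
    qed
    moreover have "hasse_edge S le (?p i) (?p k) \<longleftrightarrow> k = Suc i \<or> i = Suc k"
      if "i \<in> {1..<M}" "k \<in> {1..<M}" for i k
    proof -
      have "M - i \<in> {1..<M}" "M - k \<in> {1..<M}" using that by auto
      then have "hasse_edge S le (?p i) (?p k) \<longleftrightarrow> M - k = Suc (M - i) \<or> M - i = Suc (M - k)" by (rule p(7))
      moreover have "M - k = Suc (M - i) \<longleftrightarrow> i = Suc k" "M - i = Suc (M - k) \<longleftrightarrow> k = Suc i"
        using that by (simp_all, arith+)
      ultimately show ?thesis by blast
    qed
    ultimately show ?thesis using that[of M ?p "1 - \<delta>"] p False by auto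
  qed
qed

lemma sequence_model:
  assumes conn: "hasse_connected S le"
  obtains p :: "nat \<Rightarrow> 'a" and M t :: nat where "0 < t" "2 * t \<le> M" "coprime t M" "bij_betw p {1..<M} S"
    "\<And>a b. a \<in> {1..<M} \<Longrightarrow> b \<in> {1..<M} \<Longrightarrow> le (p a) (p b) \<longleftrightarrow> seq_le M t a b"
proof -
  obtain p :: "nat \<Rightarrow> 'a" and M :: nat and \<delta> :: real where p: "2 \<le> M" "bij_betw p {1..<M} S" "0 < \<delta>" "\<delta> \<le> 1 / 2" "real M * \<delta> \<in> \<int>"
    "\<And>k. k \<in> {1..<M} \<Longrightarrow> y (p k) - k * \<delta> \<in> \<int>"
    "\<And>i k. i \<in> {1..<M} \<Longrightarrow> k \<in> {1..<M} \<Longrightarrow> hasse_edge S le (p i) (p k) \<longleftrightarrow> k = Suc i \<or> i = Suc k"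
    using path_progression_half[OF conn] by metis
  have M0: "0 < M" using p by simp
  have "real M * \<delta> \<in> \<nat>" using p(3,5) M0 by (auto simp: Nats_altdef2)
  then obtain t where t: "real M * \<delta> = real t" by (auto elim: Nats_cases)
  have \<delta>: "\<delta> = t / M" using t M0 by (simp add: field_simps)
  have t0: "0 < t" using \<delta> p(3) M0 by (cases t) auto
  have tM: "2 * t \<le> M" using p(4) M0 unfolding \<delta> by (simp add: field_simps)
  have inS: "p k \<in> S" if "k \<in> {1..<M}" for k using p(2) that by (auto simp: bij_betw_def)
  have peq: "p i = p k \<longleftrightarrow> i = k" if "i \<in> {1..<M}" "k \<in> {1..<M}" for i k
    using p(2) that by (auto simp: bij_betw_def inj_on_def)
  let ?b = "blk M t"
  \<comment> \<open>As \<open>y\<close> lies strictly between 0 and 1, it is the fractional part of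
    \<open>k * \<delta> = k * t / M\<close>.\<close>
  have yk: "y (p k) = k * \<delta> - ?b k" if k: "k \<in> {1..<M}" for k
  proof -
    obtain q :: int where q: "y (p k) - k * \<delta> = of_int q" using p(6)[OF k] by (auto elim: Ints_cases)
    have b: "0 < y (p k)" "y (p k) < 1" using y_pos z_pos y_plus_z inS[OF k] by (auto, smt (verit))
    then have "\<lfloor>k * \<delta>\<rfloor> = - q" using q by (intro floor_unique) (simp_all add: algebra_simps)
    moreover have "\<lfloor>k * \<delta>\<rfloor> = int (?b k)"
    proof -
      have "k * \<delta> = real (k * t) / real M" by (simp add: \<delta>)
      then show ?thesis unfolding blk_def by (simp only: floor_divide_of_nat_eq)
    qed
    ultimately show ?thesis using q by simp
  qed
  \<comment> \<open>A common divisor \<open>g > 1\<close> would make the progression integral at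
    index \<open>M div g\<close>, where \<open>y\<close> would then be 0.\<close>
  have cop: "coprime t M"
  proof (rule ccontr)
    assume "\<not> coprime t M"
    define g where "g = gcd t M"
    have "g \<noteq> 1" using \<open>\<not> coprime t M\<close> by (simp add: g_def coprime_iff_gcd_eq_1)
    moreover have "0 < g" using M0 by (simp add: g_def)
    ultimately have "1 < g" by simp
    obtain t' M' where tM': "t = g * t'" "M = g * M'" unfolding g_def by (meson dvdE gcd_dvd1 gcd_dvd2)
    have "0 < M'" using M0 tM' by (cases M') auto
    then have k: "M' \<in> {1..<M}" using tM' \<open>1 < g\<close> by auto
    have "?b M' = t'" using tM' M0 by (simp add: blk_def mult.left_commute[of M'] mult.commute[of M'])
    moreover have "M' * \<delta> = t'" using tM' M0 by (simp add: \<delta>)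
    ultimately have "y (p M') = 0" using yk[OF k] by simp
    then show False using y_pos[OF inS[OF k]] by simp
  qed
  \<comment> \<open>Without a change of block \<open>y\<close> grows by \<delta>, with a change it
    drops by 1 - \<delta>; since \<open>y\<close> decreases along covers, this determines the
    direction of the edge.\<close>
  have cov: "covers S le (p k) (p (Suc k)) \<longleftrightarrow> ?b (Suc k) = Suc (?b k)"
    "covers S le (p (Suc k)) (p k) \<longleftrightarrow> ?b (Suc k) = ?b k"
    if k: "k \<in> {1..<M}" "Suc k \<in> {1..<M}" for k
  proof -
    have e: "hasse_edge S le (p k) (p (Suc k))" using p(7) k by blast
    have diff: "y (p (Suc k)) - y (p k) = \<delta> - (real (?b (Suc k)) - real (?b k))"
      using yk[OF k(1)] yk[OF k(2)] by (simp add: algebra_simps)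
    from blk_Suc[OF tM M0, of k] show
      "covers S le (p k) (p (Suc k)) \<longleftrightarrow> ?b (Suc k) = Suc (?b k)"
      "covers S le (p (Suc k)) (p k) \<longleftrightarrow> ?b (Suc k) = ?b k"
      using e diff p(3,4) y_less[of "p k" "p (Suc k)"] y_less[of "p (Suc k)" "p k"]
      by (auto simp: hasse_edge_def)
  qed
  have fwd: "seq_le M t a b" if "(covers S le)\<^sup>*\<^sup>* (p a) x" "a \<in> {1..<M}" "b \<in> {1..<M}" "x = p b" for a b x
    using that
  proof (induction arbitrary: b rule: rtranclp_induct)
    case base
    then have "a = b" using peq by blast
    then show ?case by (simp add: seq_le_def)
  next
    case (step x w)
    have "x \<in> S" using step.hyps(2) covers_in by blast
    then obtain c where c: "c \<in> {1..<M}" "x = p c" using p(2) by (auto simp: bij_betw_def)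
    have ac: "seq_le M t a c" using step.IH[of c] c step.prems by blast
    have "hasse_edge S le (p c) (p b)" using step.hyps step.prems c by (auto simp: hasse_edge_def)
    then consider "b = Suc c" "?b b = Suc (?b c)" | "c = Suc b" "?b c = ?b b"
      using p(7)[of c b] cov(1)[of c] cov(2)[of b] c step by blast
    then show ?case
    proof cases
      case 1
      \<comment> \<open>An ascent to the next block leaves the last index of a block, so nothing of
        that block lies below \<open>c\<close>; and a preceding ascent would make two changes of
        block in a row.\<close>
      have "a = c"
      proof (rule ccontr)
        assume "a \<noteq> c"
        then consider "?b a = ?b c" "c < a" | "c = Suc a" "?b c = Suc (?b a)"
          using ac by (auto simp: seq_le_def)
        then show False
        proof cases
          case down: 1
          have "?b b \<le> ?b a" using blk_mono[of b a M t] 1 down by linarith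
          then show False using 1 down by simp
        next
          case 2
          then show False using blk_Suc_Suc[OF tM M0, of a] 1 by simp
        qed
      qed
      then show ?thesis using 1 by (simp add: seq_le_def)
    next
      case 2
      then show ?thesis using ac by (auto simp: seq_le_def)
    qed
  qed
  have bwd: "le (p a) (p b)" if "?b a = ?b b" "b \<le> a" "a \<in> {1..<M}" "b \<in> {1..<M}" for a b
    using that
  proof (induction "a - b" arbitrary: a)
    case 0
    then show ?case using refl inS by simp
  next
    case (Suc d)
    then obtain c where c: "a = Suc c" "b \<le> c" by (cases a) auto
    have "?b c = ?b b" using blk_mono[of b c M t] blk_mono[of c a M t] c Suc.prems by simp
    then have "le (p c) (p b)" using Suc c by auto
    moreover have "covers S le (p a) (p c)" using cov(2)[of c] c Suc.prems \<open>?b c = ?b b\<close> by auto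
    ultimately show ?case using trans[of "p a" "p c" "p b"] inS c Suc.prems
      by (auto simp: covers_def pless_def)
  qed
  have "le (p a) (p b) \<longleftrightarrow> seq_le M t a b" if ab: "a \<in> {1..<M}" "b \<in> {1..<M}" for a b
  proof
    assume "le (p a) (p b)"
    then show "seq_le M t a b" using fwd[OF le_imp_covers_rtranclp] inS ab by blast
  next
    assume "seq_le M t a b"
    then consider "?b a = ?b b" "b \<le> a" | "b = Suc a" "?b b = Suc (?b a)" by (auto simp: seq_le_def)
    then show "le (p a) (p b)"
    proof cases
      case 1
      then show ?thesis using bwd ab by blast
    next
      case 2
      then show ?thesis using cov(1)[of a] ab by (auto simp: covers_def pless_def)
    qed
  qed
  then show ?thesis using that[OF t0 tM cop p(2)] by blast
qed

end

text \<open>The last index before chain number \<open>i\<close>. The \<open>- 1\<close> makes the last chain end at \<open>M - 1\<close>;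
  for \<open>i = 0\<close> it truncates and gives \<open>0\<close>.\<close>

definition blk_end :: "nat \<Rightarrow> nat \<Rightarrow> nat \<Rightarrow> nat" where
  "blk_end M t i = (i * M - 1) div t"

definition blk_sizes :: "nat \<Rightarrow> nat \<Rightarrow> nat list" where
  "blk_sizes M t = map (\<lambda>i. blk_end M t (Suc i) - blk_end M t i) [0..<t]"

lemma blk_end_mono: "i \<le> j \<Longrightarrow> blk_end M t i \<le> blk_end M t j"
  unfolding blk_end_def by (intro div_le_mono diff_le_mono mult_le_mono1)

lemma blk_end_0 [simp]: "blk_end M t 0 = 0"
  by (simp add: blk_end_def)

lemma blk_end_last:
  assumes "0 < t" "0 < M"
  shows "blk_end M t t = M - 1"
proof -
  have "t * M - 1 = t * (M - 1) + (t - 1)" using assms by (cases M) (auto simp: algebra_simps)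
  moreover have "(t * (M - 1) + (t - 1)) div t = M - 1"
  proof (rule div_nat_eqI)
    obtain m where "M = Suc m" using assms by (cases M) auto
    then show "t * (M - 1) + (t - 1) < t * Suc (M - 1)" using assms by simp
  qed simp
  ultimately show ?thesis by (simp only: blk_end_def)
qed

text \<open>Block \<open>i\<close> consists of the \<open>k\<close> with
  \<open>i * M \<le> k * t < Suc i * M\<close>; dividing by \<open>t\<close> turns the bounds into
  block ends.\<close>

lemma blk_iff:
  assumes "0 < t" "0 < M" "1 \<le> k"
  shows "blk M t k = i \<longleftrightarrow> blk_end M t i < k \<and> k \<le> blk_end M t (Suc i)"
proof -
  have up: "k \<le> blk_end M t (Suc i) \<longleftrightarrow> k * t < Suc i * M"
    unfolding blk_end_def less_eq_div_iff_mult_less_eq[OF assms(1)] using assms(2) by (auto simp: less_eq_iff_succ_less)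
  have lo: "blk_end M t i < k \<longleftrightarrow> i * M \<le> k * t"
  proof -
    have "k \<le> blk_end M t i \<longleftrightarrow> k * t \<le> i * M - 1"
      unfolding blk_end_def by (rule less_eq_div_iff_mult_less_eq[OF assms(1)])
    \<comment> \<open>For \<open>i = 0\<close> the subtraction truncates, and both sides are false
      since \<open>k\<close> and \<open>t\<close> are positive.\<close>
    also have "\<dots> \<longleftrightarrow> k * t < i * M" using assms by (cases "i * M") auto
    finally show ?thesis by auto
  qed
  have "blk M t k = i \<longleftrightarrow> i * M \<le> k * t \<and> k * t < Suc i * M"
    unfolding blk_def using assms(2) by (metis div_nat_eqI div_less_iff_less_mult less_eq_div_iff_mult_less_eq lessI mult.commute order_refl)
  then show ?thesis unfolding up lo by blast
qed

lemma blk_less: "k < M \<Longrightarrow> 0 < t \<Longrightarrow> blk M t k < t"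
  unfolding blk_def by (simp add: div_less_iff_less_mult)

lemma seq_iso_wattle:
  assumes t: "0 < t" "0 < M"
  shows "poset_iso {1..<M} (seq_le M t) (wattle_carrier (blk_sizes M t)) (wattle_le (blk_sizes M t))"
proof -
  let ?b = "blk M t" and ?e = "blk_end M t" and ?ns = "blk_sizes M t"
  \<comment> \<open>Counting back from the block end gives the last index of a block the position 0,
    that of the minimal element.\<close>
  let ?f = "\<lambda>k. (?b k, ?e (Suc (?b k)) - k)"
  have len: "length ?ns = t" by (simp add: blk_sizes_def)
  have nth: "?ns ! i = ?e (Suc i) - ?e i" if "i < t" for i using that by (simp add: blk_sizes_def)
  have bk: "?e (?b k) < k" "k \<le> ?e (Suc (?b k))" "?b k < t" if "k \<in> {1..<M}" for k
    using blk_iff[OF t, of k "?b k"] blk_less[of k M t] t that by auto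
  have bij: "bij_betw ?f {1..<M} (wattle_carrier ?ns)"
  proof (rule bij_betw_byWitness[where f' = "\<lambda>(i, j). ?e (Suc i) - j"])
    show "\<forall>k\<in>{1..<M}. (case ?f k of (i, j) \<Rightarrow> ?e (Suc i) - j) = k" using bk by auto
    have inv: "?e (Suc i) - j \<in> {1..<M} \<and> ?b (?e (Suc i) - j) = i" if "i < t" "j < ?e (Suc i) - ?e i" for i j
    proof -
      have "?e (Suc i) \<le> M - 1" using blk_end_mono[of "Suc i" t M t] blk_end_last[OF t] that by simp
      then have "?e (Suc i) - j \<in> {1..<M}" using that t by auto
      then show ?thesis using blk_iff[OF t, of "?e (Suc i) - j" i] that by auto
    qed
    show "\<forall>a\<in>wattle_carrier ?ns. ?f (case a of (i, j) \<Rightarrow> ?e (Suc i) - j) = a"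
    proof
      fix a assume "a \<in> wattle_carrier ?ns"
      then obtain i j where a: "a = (i, j)" "i < t" "j < ?e (Suc i) - ?e i"
        using nth len by (auto simp: wattle_carrier_def)
      then show "?f (case a of (i, j) \<Rightarrow> ?e (Suc i) - j) = a" using inv[OF a(2,3)] by simp
    qed
    show "?f ` {1..<M} \<subseteq> wattle_carrier ?ns"
    proof
      fix a assume "a \<in> ?f ` {1..<M}"
      then obtain k where k: "k \<in> {1..<M}" "a = ?f k" by blast
      then show "a \<in> wattle_carrier ?ns" using bk[OF k(1)] nth[of "?b k"] len by (auto simp: wattle_carrier_def)
    qed
    show "(\<lambda>(i, j). ?e (Suc i) - j) ` wattle_carrier ?ns \<subseteq> {1..<M}"
    proof
      fix k assume "k \<in> (\<lambda>(i, j). ?e (Suc i) - j) ` wattle_carrier ?ns"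
      then obtain i j where "i < t" "j < ?ns ! i" "k = ?e (Suc i) - j"
        using len by (auto simp: wattle_carrier_def)
      then show "k \<in> {1..<M}" using inv[of i j] nth[of i] by simp
    qed
  qed
  have "seq_le M t x y \<longleftrightarrow> wattle_le ?ns (?f x) (?f y)" if x: "x \<in> {1..<M}" and y: "y \<in> {1..<M}" for x y
  proof -
    have 1: "?b x = ?b y \<and> y \<le> x \<longleftrightarrow> fst (?f x) = fst (?f y) \<and> snd (?f x) \<le> snd (?f y)"
      using bk[OF x] bk[OF y] by auto
    have 2: "y = Suc x \<and> ?b y = Suc (?b x) \<longleftrightarrow>
        fst (?f y) = fst (?f x) + 1 \<and> snd (?f x) = 0 \<and> snd (?f y) = ?ns ! fst (?f y) - 1"
    proof (cases "?b y = Suc (?b x)")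
      case True
      then show ?thesis using bk[OF x] bk[OF y] nth[of "?b y"] by auto
    qed auto
    show ?thesis unfolding seq_le_def wattle_le_def 1 2 ..
  qed
  then show ?thesis unfolding poset_iso_def using bij by blast
qed

text \<open>With \<open>a = M - t\<close>, a block end with \<open>0 < j < t\<close> is
  \<open>j * a div t + j\<close>, whose differences are the inner entries of
  \<open>zeta_list\<close>; the outer two entries need the ends 0 and \<open>M - 1\<close>.\<close>

lemma zeta_list_ratio:
  assumes t: "0 < t" "t \<le> M" and cop: "coprime t M"
  shows "zeta_list (rat_of_nat (M - t) / rat_of_nat t) = blk_sizes M t"
proof -
  define a where "a = M - t"
  have M: "M = a + t" using t by (simp add: a_def)
  let ?r = "rat_of_nat a / rat_of_nat t"
  have fl: "\<lfloor>?r * of_nat j\<rfloor> = int (j * a div t)" for j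
  proof -
    have "?r * of_nat j = rat_of_nat (j * a) / rat_of_nat t" by simp
    then show ?thesis by (simp only: floor_divide_of_nat_eq)
  qed
  have fl1: "\<lfloor>?r\<rfloor> = int (a div t)" using fl[of 1] by simp
  have "M = t + a" using M by simp
  then have copa: "coprime t a"
    using cop unfolding coprime_iff_gcd_eq_1 by (simp only: gcd_add2)
  show ?thesis
  proof (cases "t = 1")
    case True
    then show ?thesis using M by (simp add: zeta_list_def a_def[symmetric] blk_sizes_def blk_end_def)
  next
    case False
    then have t2: "2 \<le> t" using t by simp
    have nd: "\<not> t dvd a"
    proof
      assume "t dvd a"
      then have "t dvd gcd t a" by simp
      then show False using copa False by (simp add: coprime_iff_gcd_eq_1)
    qed
    then have d0: "0 < a mod t" by (simp add: mod_greater_zero_iff_not_dvd)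
    have nint: "?r \<notin> \<int>"
    proof
      assume "?r \<in> \<int>"
      then have "?r = of_int \<lfloor>?r\<rfloor>" by (auto elim: Ints_cases)
      then have "rat_of_nat a = rat_of_nat (a div t * t)" using fl1 t by (simp add: field_simps)
      then have "a = a div t * t" by (simp only: of_nat_eq_iff)
      then show False using nd by (metis dvd_triv_right)
    qed
    have den: "snd (quotient_of (?r - of_int \<lfloor>?r\<rfloor>)) = int t"
    proof -
      have "rat_of_nat a = rat_of_nat (a div t) * rat_of_nat t + rat_of_nat (a mod t)"
        by (metis of_nat_add of_nat_mult div_mult_mod_eq)
      then have "?r - of_int \<lfloor>?r\<rfloor> = Fract (int (a mod t)) (int t)"
        using t unfolding fl1 by (simp add: Fract_of_int_quotient field_simps)
      moreover have "coprime (int (a mod t)) (int t)"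
        using copa t coprime_mod_right_iff[of t a] by (simp add: coprime_commute)
      ultimately show ?thesis using t by (simp add: quotient_of_Fract normalize_stable)
    qed
    \<comment> \<open>By coprimality \<open>t\<close> does not divide \<open>j * M\<close>, so
      subtracting 1 before the division does not change the quotient.\<close>
    have ei: "blk_end M t j = j * a div t + j" if "0 < j" "j < t" for j
    proof -
      have "\<not> t dvd j * M"
        using cop that by (metis coprime_dvd_mult_left_iff nat_dvd_not_less)
      then have "0 < j * M mod t" by (simp add: mod_greater_zero_iff_not_dvd)
      moreover have "j * M mod t < t" using t by simp
      moreover have "t * (j * M div t) + j * M mod t = j * M" by (rule mult_div_mod_eq)
      ultimately have "t * (j * M div t) \<le> j * M - 1" "j * M - 1 < t * (j * M div t) + t"
        by linarith+
      then have "(j * M - 1) div t = j * M div t" by (intro div_nat_eqI) simp_all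
      moreover have "j * M = j * a + j * t" using M by (simp add: algebra_simps)
      ultimately show ?thesis using t by (simp add: blk_end_def)
    qed
    have last: "blk_end M t t - blk_end M t (t - 1) = a div t + 1"
    proof -
      \<comment> \<open>The two quotients round down complementary non-integers adding up to
        \<open>a\<close>, hence lose exactly 1 together.\<close>
      have "(t - 1) * a div t + a div t + 1 = a"
      proof -
        define c d where "c = a div t" and "d = a mod t"
        have a: "a = t * c + d" "d < t" "0 < d" using d0 t by (auto simp: c_def d_def)
        have "c \<le> t * c" using t by simp
        then have "c + 1 \<le> a" using a by linarith
        then obtain f where f: "a = c + 1 + f" using le_Suc_ex by blast
        have "(t - 1) * a + a = t * a" using t by (cases t) auto
        then have "(t - 1) * a = t * f + (t - d)" using f a by (simp add: algebra_simps)
        moreover have "t - d < t" using a by simp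
        ultimately have "(t - 1) * a div t = f" by simp
        then show ?thesis using f unfolding c_def[symmetric] by linarith
      qed
      then show ?thesis using ei[of "t - 1"] blk_end_last[of t M] M t t2 by simp
    qed
    have "blk_sizes M t ! i = zeta_list ?r ! i" if i: "i < t" for i
    proof -
      have z: "zeta_list ?r ! i = (if i = 0 \<or> i = t - 1 then a div t + 1
          else nat (int ((i + 1) * a div t) - int (i * a div t)) + 1)"
        using nint den i fl[of "i + 1"] fl[of i] fl1 by (simp add: zeta_list_def Let_def)
      have b: "blk_sizes M t ! i = blk_end M t (Suc i) - blk_end M t i" using i by (simp add: blk_sizes_def)
      consider "i = 0" | "i = t - 1" | "0 < i" "Suc i < t" using i by linarith
      then show ?thesis
      proof cases
        case 1
        then show ?thesis unfolding z b using ei[of 1] t2 by simp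
      next
        case 2
        then show ?thesis unfolding z b using last t by simp
      next
        case 3
        have "i * a div t \<le> (i + 1) * a div t" by (intro div_le_mono mult_le_mono1) simp
        then show ?thesis unfolding z b using ei[of i] ei[of "Suc i"] 3
          by (simp add: nat_diff_distrib Suc_diff_le)
      qed
    qed
    moreover have "length (zeta_list ?r) = t" using nint den by (simp add: zeta_list_def Let_def)
    moreover have "length (blk_sizes M t) = t" by (simp add: blk_sizes_def)
    ultimately have "blk_sizes M t = zeta_list ?r" by (intro nth_equalityI) auto
    then show ?thesis by (simp add: a_def)
  qed
qed

section \<open>The isomorphism with \<open>\<zeta>(r)\<close>\<close>

lemma poset_iso_trans:
  assumes "poset_iso A le B le'" "poset_iso B le' C le''"
  shows "poset_iso A le C le''"
proof -
  obtain f g where f: "bij_betw f A B" "\<forall>x\<in>A. \<forall>y\<in>A. le x y \<longleftrightarrow> le' (f x) (f y)"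
    and g: "bij_betw g B C" "\<forall>x\<in>B. \<forall>y\<in>B. le' x y \<longleftrightarrow> le'' (g x) (g y)"
    using assms unfolding poset_iso_def by blast
  have "bij_betw (g \<circ> f) A C" using f(1) g(1) by (rule bij_betw_trans)
  moreover have "\<forall>x\<in>A. \<forall>y\<in>A. le x y \<longleftrightarrow> le'' ((g \<circ> f) x) ((g \<circ> f) y)"
    using f g bij_betwE[OF f(1)] by auto
  ultimately show ?thesis unfolding poset_iso_def by blast
qed

lemma poset_iso_sym:
  assumes "poset_iso A le B le'"
  shows "poset_iso B le' A le"
proof -
  obtain f where f: "bij_betw f A B" "\<forall>x\<in>A. \<forall>y\<in>A. le x y \<longleftrightarrow> le' (f x) (f y)"
    using assms unfolding poset_iso_def by blast
  let ?g = "the_inv_into A f"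
  have g: "bij_betw ?g B A" by (rule bij_betw_the_inv_into[OF f(1)])
  have "f (?g x) = x" if "x \<in> B" for x
    using f_the_inv_into_f_bij_betw[OF f(1)] that by blast
  then have "\<forall>x\<in>B. \<forall>y\<in>B. le' x y \<longleftrightarrow> le (?g x) (?g y)" using f(2) bij_betwE[OF g] by metis
  then show ?thesis unfolding poset_iso_def using g by blast
qed

lemma (in ascent_free_poset) iso_zeta:
  assumes "hasse_connected S le"
  shows "\<exists>r::rat. r \<ge> 1 \<and> poset_iso S le (zeta_carrier r) (zeta_le r)"
proof -
  obtain p M t where p: "0 < t" "2 * t \<le> M" "coprime t M" "bij_betw p {1..<M} S"
    "\<And>a b. a \<in> {1..<M} \<Longrightarrow> b \<in> {1..<M} \<Longrightarrow> le (p a) (p b) \<longleftrightarrow> seq_le M t a b"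
    using sequence_model[OF assms] by metis
  let ?r = "rat_of_nat (M - t) / rat_of_nat t"
  have "poset_iso {1..<M} (seq_le M t) S le" unfolding poset_iso_def using p(4,5) by blast
  then have "poset_iso S le (wattle_carrier (blk_sizes M t)) (wattle_le (blk_sizes M t))"
    using poset_iso_trans[OF poset_iso_sym seq_iso_wattle[of t M]] p by simp
  then have "poset_iso S le (zeta_carrier ?r) (zeta_le ?r)"
    using zeta_list_ratio[of t M] p unfolding zeta_carrier_def zeta_le_def by simp
  moreover have "1 \<le> ?r" using p by (simp add: of_nat_diff)
  ultimately show ?thesis by blast
qed

section \<open>The posets \<open>\<zeta>(r)\<close>\<close>

lemma no_ascent_iso:
  assumes iso: "poset_iso S le T le'" and na: "no_ascent T le'"
  shows "no_ascent S le"
  unfolding no_ascent_def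
proof (intro allI impI ballI)
  fix h i assume h: "(\<Sum>i\<in>S. h i) = 0 \<and> (\<forall>i\<in>S. grad S le h i \<ge> 0)" and i: "i \<in> S"
  obtain f where f: "bij_betw f S T" "\<forall>x\<in>S. \<forall>y\<in>S. le x y \<longleftrightarrow> le' (f x) (f y)"
    using iso unfolding poset_iso_def by blast
  define g where "g x = h (the_inv_into S f x)" for x
  have gf: "g (f x) = h x" if "x \<in> S" for x
    using f(1) that by (simp add: g_def the_inv_into_f_f bij_betw_def)
  have "(\<Sum>x\<in>T. g x) = (\<Sum>x\<in>S. g (f x))" using sum.reindex_bij_betw[OF f(1), of g] by simp
  also have "\<dots> = 0" using h gf by simp
  finally have s0: "(\<Sum>x\<in>T. g x) = 0" .
  have gr: "grad T le' g (f x) = grad S le h x" if "x \<in> S" for x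
  proof -
    have "grad T le' g (f x) =
      (\<Sum>y\<in>S. ((if le' (f x) (f y) then 1 else 0) + (if le' (f y) (f x) then 1 else 0)) * g (f y))"
      unfolding grad_matrix
      using sum.reindex_bij_betw[OF f(1), of "\<lambda>y. ((if le' (f x) y then 1 else 0) + (if le' y (f x) then 1 else 0)) * g y"]
      by simp
    also have "\<dots> = grad S le h x" unfolding grad_matrix using f(2) that gf by (intro sum.cong) auto
    finally show ?thesis .
  qed
  have "grad T le' g x \<ge> 0" if "x \<in> T" for x
  proof -
    obtain w where "w \<in> S" "x = f w" using f(1) \<open>x \<in> T\<close> by (auto simp: bij_betw_def)
    then show ?thesis using gr h by simp
  qed
  then have "g (f i) = 0" using no_ascentD[OF na s0] f(1) i by (auto simp: bij_betw_def)
  then show "h i = 0" using gf[OF i] by simp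
qed

section \<open>The gradient on wattles\<close>

lemma wattle_carrier_Sigma: "wattle_carrier ns = Sigma {..<length ns} (\<lambda>i. {..<ns ! i})"
  by (auto simp: wattle_carrier_def)

lemma grad_wattle:
  assumes i: "i < length ns" and k: "k < ns ! i" and pos: "\<And>j. j < length ns \<Longrightarrow> 0 < ns ! j"
  shows "grad (wattle_carrier ns) (wattle_le ns) h (i, k) =
    h (i, k) + (\<Sum>l<ns ! i. h (i, l))
    + (if k = 0 \<and> Suc i < length ns then h (Suc i, ns ! Suc i - 1) else 0)
    + (if k = ns ! i - 1 \<and> 0 < i then h (i - 1, 0) else 0)"
proof -
  let ?n = "\<lambda>j. ns ! j" and ?t = "length ns"
  have up: "up_sum (wattle_carrier ns) (wattle_le ns) h (i, k) =
      (\<Sum>l<?n i. if k \<le> l then h (i, l) else 0)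
      + (if k = 0 \<and> Suc i < ?t then h (Suc i, ?n (Suc i) - 1) else 0)"
  proof -
    have "up_sum (wattle_carrier ns) (wattle_le ns) h (i, k)
      = (\<Sum>j<?t. \<Sum>l<?n j. if wattle_le ns (i, k) (j, l) then h (j, l) else 0)"
      unfolding up_sum_def wattle_carrier_Sigma by (simp add: sum.Sigma)
    also have "\<dots> = (\<Sum>j<?t. (if j = i then (\<Sum>l<?n i. if k \<le> l then h (i, l) else 0) else 0)
        + (if j = Suc i then (if k = 0 then h (Suc i, ?n (Suc i) - 1) else 0) else 0))"
    proof (rule sum.cong[OF refl])
      fix j assume "j \<in> {..<?t}"
      then have j: "0 < ?n j" using pos by simp
      consider "j = i" | "j = Suc i" | "j \<noteq> i" "j \<noteq> Suc i" by blast
      then show "(\<Sum>l<?n j. if wattle_le ns (i, k) (j, l) then h (j, l) else 0) =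
        (if j = i then (\<Sum>l<?n i. if k \<le> l then h (i, l) else 0) else 0)
        + (if j = Suc i then (if k = 0 then h (Suc i, ?n (Suc i) - 1) else 0) else 0)"
      proof cases
        case 2
        have "(\<Sum>l<?n j. if wattle_le ns (i, k) (j, l) then h (j, l) else 0)
          = (\<Sum>l<?n j. if l = ?n j - 1 then (if k = 0 then h (j, l) else 0) else 0)"
          using 2 by (intro sum.cong refl) (auto simp: wattle_le_def)
        then show ?thesis using 2 j by (simp add: sum.delta)
      qed (auto simp: wattle_le_def intro!: sum.neutral)
    qed
    also have "\<dots> = (\<Sum>l<?n i. if k \<le> l then h (i, l) else 0)
      + (if k = 0 \<and> Suc i < ?t then h (Suc i, ?n (Suc i) - 1) else 0)"
      using i by (simp add: sum.distrib sum.delta)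
    finally show ?thesis .
  qed
  have down: "down_sum (wattle_carrier ns) (wattle_le ns) h (i, k) =
      (\<Sum>l<?n i. if l \<le> k then h (i, l) else 0)
      + (if k = ?n i - 1 \<and> 0 < i then h (i - 1, 0) else 0)"
  proof -
    have "down_sum (wattle_carrier ns) (wattle_le ns) h (i, k)
      = (\<Sum>j<?t. \<Sum>l<?n j. if wattle_le ns (j, l) (i, k) then h (j, l) else 0)"
      unfolding up_sum_def wattle_carrier_Sigma by (simp add: sum.Sigma)
    \<comment> \<open>At \<open>i = 0\<close> the index \<open>i - 1\<close> truncates to 0; the
      guard \<open>0 < i\<close> removes this spurious term.\<close>
    also have "\<dots> = (\<Sum>j<?t. (if j = i then (\<Sum>l<?n i. if l \<le> k then h (i, l) else 0) else 0)
        + (if j = i - 1 then (if k = ?n i - 1 \<and> 0 < i then h (i - 1, 0) else 0) else 0))"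
    proof (rule sum.cong[OF refl])
      fix j assume "j \<in> {..<?t}"
      then have j: "0 < ?n j" using pos by simp
      consider "j = i" | "i = Suc j" | "j \<noteq> i" "i \<noteq> Suc j" by blast
      then show "(\<Sum>l<?n j. if wattle_le ns (j, l) (i, k) then h (j, l) else 0) =
        (if j = i then (\<Sum>l<?n i. if l \<le> k then h (i, l) else 0) else 0)
        + (if j = i - 1 then (if k = ?n i - 1 \<and> 0 < i then h (i - 1, 0) else 0) else 0)"
      proof cases
        case 1
        then show ?thesis by (auto simp: wattle_le_def)
      next
        case 2
        have "(\<Sum>l<?n j. if wattle_le ns (j, l) (i, k) then h (j, l) else 0)
          = (\<Sum>l<?n j. if l = 0 then (if k = ?n i - 1 then h (j, l) else 0) else 0)"
          using 2 by (intro sum.cong refl) (auto simp: wattle_le_def)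
        then show ?thesis using 2 j by (simp add: sum.delta)
      next
        case 3
        then show ?thesis by (auto simp: wattle_le_def intro!: sum.neutral)
      qed
    qed
    also have "\<dots> = (\<Sum>l<?n i. if l \<le> k then h (i, l) else 0)
      + (if k = ?n i - 1 \<and> 0 < i then h (i - 1, 0) else 0)"
      using i by (simp add: sum.distrib sum.delta)
    finally show ?thesis .
  qed
  have "(\<Sum>l<?n i. if k \<le> l then h (i, l) else 0) + (\<Sum>l<?n i. if l \<le> k then h (i, l) else 0)
      = (\<Sum>l<?n i. h (i, l)) + (\<Sum>l<?n i. if l = k then h (i, l) else 0)"
    unfolding sum.distrib[symmetric] by (intro sum.cong) auto
  also have "(\<Sum>l<?n i. if l = k then h (i, l) else 0) = h (i, k)" using k by (simp add: sum.delta)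
  finally show ?thesis unfolding grad_def up down by simp
qed

text \<open>An explicit positive \<open>v\<close> with constant gradient forces
  \<open>grad h = 0\<close>; the linear equations are then solved chain by chain. The numbers
  \<open>m i\<close> say how each link splits a total weight of 1 between its two elements.\<close>

lemma no_ascent_wattle:
  fixes ns :: "nat list" and m :: "nat \<Rightarrow> real"
  assumes ne: "ns \<noteq> []" and pos: "\<And>j. j < length ns \<Longrightarrow> 0 < ns ! j"
    and two: "1 < length ns \<Longrightarrow> (\<And>j. j < length ns \<Longrightarrow> 2 \<le> ns ! j)"
    and m0: "m 0 = 0" and mt: "m (length ns) = 1"
    and m: "\<And>i. 0 < i \<Longrightarrow> i < length ns \<Longrightarrow> 0 < m i \<and> m i < 1"
    and eq: "\<And>i. i < length ns \<Longrightarrow> real (ns ! i) - 1 + m (Suc i) - m i = r"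
  shows "no_ascent (wattle_carrier ns) (wattle_le ns)"
  unfolding no_ascent_def
proof (intro allI impI)
  let ?C = "wattle_carrier ns" and ?le = "wattle_le ns" and ?n = "\<lambda>j. ns ! j" and ?t = "length ns"
  fix h assume h: "(\<Sum>x\<in>?C. h x) = 0 \<and> (\<forall>x\<in>?C. 0 \<le> grad ?C ?le h x)"
  \<comment> \<open>The minimum of chain \<open>i\<close> gets \<open>m (Suc i)\<close>, the maximum
    \<open>1 - m i\<close>, and the rest 1, so linked elements add up to 1. The values
    \<open>m 0 = 0\<close> and \<open>m (length ns) = 1\<close> give the unlinked ends weight
    1.\<close>
  define v where "v x = (if snd x = 0 then m (Suc (fst x)) else 1)
      - (if snd x = ?n (fst x) - 1 then m (fst x) else 0)" for x
  have t0: "0 < ?t" using ne by simp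
  have two': "2 \<le> ?n j" if "j < ?t" "0 < i" "i < ?t" for i j using two[of j] that by simp
  have sumv: "(\<Sum>l<?n i. v (i, l)) = r" if i: "i < ?t" for i
  proof -
    have "(\<Sum>l<?n i. v (i, l)) = (\<Sum>l<?n i. 1 + (if l = 0 then m (Suc i) - 1 else 0)
        - (if l = ?n i - 1 then m i else 0))"
      by (intro sum.cong) (auto simp: v_def)
    also have "\<dots> = real (?n i) + (m (Suc i) - 1) - m i"
      using pos[OF i] by (simp add: sum.distrib sum_subtractf sum.delta)
    finally show ?thesis using eq[OF i] by simp
  qed
  have gradv: "grad ?C ?le v (i, k) = r + 1" if i: "i < ?t" and k: "k < ?n i" for i k
  proof -
    have up: "v (Suc i, ?n (Suc i) - 1) = 1 - m (Suc i)" if "Suc i < ?t"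
      using two'[of "Suc i" "Suc i"] that by (simp add: v_def)
    have dn: "v (i - 1, 0) = m i" if "0 < i"
    proof -
      have "2 \<le> ?n (i - 1)" using two'[of "i - 1" i] i that by simp
      then show ?thesis using that by (simp add: v_def)
    qed
    have top: "Suc i = ?t" if "\<not> Suc i < ?t" using i that by simp
    have z: "k \<noteq> ?n i - 1" if "k = 0" "0 < i \<or> Suc i < ?t" using two'[of i i] two'[of i "Suc i"] i that by auto
    have vik: "v (i, k) = (if k = 0 then m (Suc i) else 1) - (if k = ?n i - 1 then m i else 0)"
      by (simp add: v_def)
    have "grad ?C ?le v (i, k) = v (i, k) + r
      + (if k = 0 \<and> Suc i < ?t then v (Suc i, ?n (Suc i) - 1) else 0)
      + (if k = ?n i - 1 \<and> 0 < i then v (i - 1, 0) else 0)"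
      unfolding sumv[OF i, symmetric] by (rule grad_wattle[OF i k]) (rule pos)
    then show ?thesis
      using vik up dn top z mt m0 by (cases "k = 0"; cases "k = ?n i - 1"; cases "i = 0"; cases "Suc i < ?t") auto
  qed
  have vpos: "0 < v x" if "x \<in> ?C" for x
  proof -
    obtain i k where x: "x = (i, k)" "i < ?t" "k < ?n i" using \<open>x \<in> ?C\<close> by (auto simp: wattle_carrier_def)
    have "0 < m (Suc i)" using m[of "Suc i"] mt x by (cases "Suc i = ?t") auto
    moreover have "m i < 1" using m[of i] m0 x by (cases "i = 0") auto
    moreover have "m i = 0" if "k = 0" "k = ?n i - 1"
      using two'[of i i] x m0 that by (cases "i = 0") auto
    ultimately show ?thesis unfolding x(1) v_def by auto
  qed
  have finC: "finite ?C" unfolding wattle_carrier_Sigma by simp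
  \<comment> \<open>Symmetry turns this into \<open>r + 1\<close> times the zero sum of
    \<open>h\<close>; a zero sum of nonnegative terms with positive weights \<open>v x\<close> has
    \<open>grad h = 0\<close>.\<close>
  have "(\<Sum>x\<in>?C. v x * grad ?C ?le h x) = (\<Sum>x\<in>?C. h x * grad ?C ?le v x)" by (rule grad_symmetric)
  also have "\<dots> = (\<Sum>x\<in>?C. h x * (r + 1))"
    using gradv by (intro sum.cong) (auto simp: wattle_carrier_def)
  also have "\<dots> = 0" using h by (simp add: sum_distrib_right[symmetric])
  finally have s0: "(\<Sum>x\<in>?C. v x * grad ?C ?le h x) = 0" .
  have "0 \<le> v x * grad ?C ?le h x" if "x \<in> ?C" for x
    using vpos[OF that] h that by (intro mult_nonneg_nonneg) auto
  then have "\<forall>x\<in>?C. v x * grad ?C ?le h x = 0"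
    using s0 sum_nonneg_eq_0_iff[OF finC, of "\<lambda>x. v x * grad ?C ?le h x"] by blast
  then have g0: "grad ?C ?le h x = 0" if "x \<in> ?C" for x using vpos that by fastforce
  define V where "V i = (\<Sum>l<?n i. h (i, l))" for i
  have row: "h (i, k) + V i + (if k = 0 \<and> Suc i < ?t then h (Suc i, ?n (Suc i) - 1) else 0)
    + (if k = ?n i - 1 \<and> 0 < i then h (i - 1, 0) else 0) = 0" if "i < ?t" "k < ?n i" for i k
    using g0[of "(i, k)"] that grad_wattle[of i ns k h] pos unfolding V_def
    by (simp add: wattle_carrier_def)
  \<comment> \<open>The equations at the two ends of a link contain the same two values of
    \<open>h\<close>, so their difference leaves equal chain sums.\<close>
  have Vstep: "V (Suc i) = V i" if "Suc i < ?t" for i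
    using row[of i 0] row[of "Suc i" "?n (Suc i) - 1"] two'[of i "Suc i"] two'[of "Suc i" "Suc i"] that by auto
  have Vconst: "V i = V 0" if "i < ?t" for i using that by (induction i) (use Vstep in auto)
  have "(\<Sum>x\<in>?C. h x) = (\<Sum>i<?t. V i)" unfolding wattle_carrier_Sigma V_def by (simp add: sum.Sigma)
  also have "\<dots> = real ?t * V 0" using Vconst by simp
  finally have "V 0 = 0" using h t0 by simp
  then have V0: "V i = 0" if "i < ?t" for i using Vconst that by simp
  \<comment> \<open>Once the previous minimum is 0, every non-minimal equation of a chain reads
    \<open>h = 0\<close>; the vanishing chain sum then settles the minimum.\<close>
  have zero: "\<forall>k<?n i. h (i, k) = 0" if "i < ?t" for i
    using that
  proof (induction i)
    case 0
    have nz: "h (0, k) = 0" if "0 < k" "k < ?n 0" for k using row[of 0 k] V0[of 0] t0 that by simp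
    have "V 0 = h (0, 0) + (\<Sum>l\<in>{..<?n 0} - {0}. h (0, l))"
      unfolding V_def using pos[OF t0] by (subst sum.remove[of _ 0]) auto
    also have "(\<Sum>l\<in>{..<?n 0} - {0}. h (0, l)) = 0" using nz by (intro sum.neutral) auto
    finally have "h (0, 0) = 0" using V0[OF t0] by simp
    then show ?case using nz by (metis gr0I)
  next
    case (Suc i)
    have prev: "h (i, 0) = 0" using Suc pos[of i] by simp
    have nz: "h (Suc i, k) = 0" if "0 < k" "k < ?n (Suc i)" for k
      using row[of "Suc i" k] V0[of "Suc i"] Suc.prems that prev by (simp split: if_splits)
    have "V (Suc i) = h (Suc i, 0) + (\<Sum>l\<in>{..<?n (Suc i)} - {0}. h (Suc i, l))"
      unfolding V_def using pos[OF Suc.prems] by (subst sum.remove[of _ 0]) auto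
    also have "(\<Sum>l\<in>{..<?n (Suc i)} - {0}. h (Suc i, l)) = 0" using nz by (intro sum.neutral) auto
    finally have "h (Suc i, 0) = 0" using V0[OF Suc.prems] by simp
    then show ?case using nz by (metis gr0I)
  qed
  then show "\<forall>x\<in>?C. h x = 0" by (auto simp: wattle_carrier_def)
qed

lemma no_ascent_zeta:
  assumes "1 \<le> (r :: rat)"
  shows "no_ascent (zeta_carrier r) (zeta_le r)"
proof -
  obtain a' t' where q: "quotient_of r = (a', t')" by (cases "quotient_of r")
  have t': "0 < t'" "coprime a' t'" "r = of_int a' / of_int t'"
    using quotient_of_denom_pos[OF q] quotient_of_coprime[OF q] quotient_of_div[OF q] by auto
  have at': "t' \<le> a'" using assms t' by (simp add: field_simps)
  define a t where "a = nat a'" and "t = nat t'"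
  define M where "M = a + t"
  have a': "a' = int a" and tt': "t' = int t" using t' at' by (auto simp: a_def t_def)
  have t: "0 < t" "t \<le> a" "coprime a t" and r: "r = rat_of_nat a / rat_of_nat t"
    using t' at' unfolding a' tt' by auto
  have "M = t + a" by (simp add: M_def)
  then have cop: "coprime t M"
    using t(3) unfolding coprime_iff_gcd_eq_1 by (simp only: gcd_add2 gcd.commute)
  have M0: "0 < M" and tM: "2 * t \<le> M" using t by (auto simp: M_def)
  let ?ns = "blk_sizes M t" and ?e = "blk_end M t"
  have zl: "zeta_list r = ?ns" using zeta_list_ratio[of t M] cop t r by (simp add: M_def)
  have len: "length ?ns = t" by (simp add: blk_sizes_def)
  have nth: "?ns ! i = ?e (Suc i) - ?e i" if "i < t" for i using that by (simp add: blk_sizes_def)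
  \<comment> \<open>The distance from the last index before chain \<open>i\<close> to the real
    boundary \<open>i * M / t\<close>. Boundaries are spaced by \<open>M / t\<close>, which gives
    the constant \<open>M / t - 1\<close>.\<close>
  define m where "m i = real (i * M) / t - ?e i" for i
  have mle: "m i \<le> 1" "0 < m i" "m i = 1 \<Longrightarrow> t dvd i * M" if "0 < i" for i
  proof -
    have iM: "0 < i * M" using that M0 by simp
    have d: "i * M - 1 = ?e i * t + (i * M - 1) mod t" unfolding blk_end_def by simp
    define w where "w = (i * M - 1) mod t"
    have w: "w < t" using t by (simp add: w_def)
    have iMe: "i * M = ?e i * t + w + 1" using d iM unfolding w_def by linarith
    have "m i = (real w + 1) / t"
      unfolding m_def iMe using t by (simp add: field_simps)
    then show "m i \<le> 1" "0 < m i" using w t by simp_all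
    show "m i = 1 \<Longrightarrow> t dvd i * M"
    proof -
      assume "m i = 1"
      then have "real w + 1 = real t" using \<open>m i = (real w + 1) / t\<close> t by (simp add: field_simps)
      then have "w + 1 = t" by linarith
      then have "i * M = (?e i + 1) * t" using iMe by simp
      then show "t dvd i * M" by simp
    qed
  qed
  have big: "?e i + 1 \<le> ?e (Suc i)" if "i < t" for i
  proof -
    have "(i * M - 1) + t \<le> Suc i * M - 1" using tM t by (cases "i * M") auto
    then have "((i * M - 1) + t) div t \<le> ?e (Suc i)" unfolding blk_end_def by (rule div_le_mono)
    then show ?thesis using t by (simp add: blk_end_def)
  qed
  have big2: "?e i + 2 \<le> ?e (Suc i)" if "i < t" "1 < t" for i
  proof -
    \<comment> \<open>Strictness matters for the first chain, where \<open>i * M - 1\<close>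
      truncates to 0 and \<open>2 * t \<le> M - 1\<close> is required.\<close>
    have "2 * t \<noteq> M" using cop \<open>1 < t\<close> by auto
    then have "2 * t \<le> M - 1" using tM by simp
    then have "(i * M - 1) + 2 * t \<le> Suc i * M - 1" by (cases "i * M") auto
    then have "((i * M - 1) + 2 * t) div t \<le> ?e (Suc i)" unfolding blk_end_def by (rule div_le_mono)
    then show ?thesis using t by (simp add: blk_end_def)
  qed
  have "no_ascent (wattle_carrier ?ns) (wattle_le ?ns)"
  proof (rule no_ascent_wattle[where m = m and r = "real M / t - 1"])
    show "?ns \<noteq> []" using len t by auto
    show "0 < ?ns ! j" if "j < length ?ns" for j using nth[of j] big[of j] that len by simp
    show "2 \<le> ?ns ! j" if "1 < length ?ns" "j < length ?ns" for j using nth[of j] big2[of j] that len by simp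
    show "m 0 = 0" by (simp add: m_def)
    show "m (length ?ns) = 1"
      unfolding len m_def blk_end_last[OF t(1) M0] using t M0 by (simp add: of_nat_diff)
    show "0 < m i \<and> m i < 1" if "0 < i" "i < length ?ns" for i
    proof -
      have "\<not> t dvd i * M" using cop that len by (metis coprime_dvd_mult_left_iff nat_dvd_not_less)
      then have "m i \<noteq> 1" using mle(3)[OF that(1)] by blast
      then have "m i < 1" using mle(1)[OF that(1)] by linarith
      then show ?thesis using mle(2)[OF that(1)] by blast
    qed
    show "real (?ns ! i) - 1 + m (Suc i) - m i = real M / t - 1" if "i < length ?ns" for i
    proof -
      have "real (?ns ! i) = real (?e (Suc i)) - real (?e i)"
        using nth[of i] blk_end_mono[of i "Suc i" M t] that len by (simp add: of_nat_diff)
      then show ?thesis by (simp add: m_def add_divide_distrib distrib_right)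
    qed
  qed
  then show ?thesis unfolding zeta_carrier_def zeta_le_def zl .
qed

theorem mainTheorem1:
  fixes S :: "'a set" and le :: "'a \<Rightarrow> 'a \<Rightarrow> bool"
  assumes "finite_poset S le"
    and "hasse_connected S le"
    and "psd_on S (fS S le)"
  shows "Cset S (fS S le) = {} \<longleftrightarrow>
         (\<exists>r::rat. r \<ge> 1 \<and> poset_iso S le (zeta_carrier r) (zeta_le r))"
proof -
  have C: "Cset S (fS S le) = {} \<longleftrightarrow> no_ascent S le"
    using Cset_empty_iff[of S le] assms(1) by (simp add: finite_poset_def)
  show ?thesis
  proof
    assume "Cset S (fS S le) = {}"
    then obtain v where "ascent_free_poset S le v"
      using ascent_free_posetI[of S le] assms C by (auto simp: hasse_connected_def)
    then show "\<exists>r::rat. r \<ge> 1 \<and> poset_iso S le (zeta_carrier r) (zeta_le r)"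
      using assms(2) by (rule ascent_free_poset.iso_zeta)
  next
    assume "\<exists>r::rat. r \<ge> 1 \<and> poset_iso S le (zeta_carrier r) (zeta_le r)"
    then obtain r :: rat where r: "1 \<le> r" "poset_iso S le (zeta_carrier r) (zeta_le r)" by blast
    show "Cset S (fS S le) = {}"
      unfolding C by (rule no_ascent_iso[OF r(2) no_ascent_zeta[OF r(1)]])
  qed
qed

end
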